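(* Let $G$ be a directed acyclic graph with a unique source $s$ and a unique sink $t$, such that $G$ is max-unique, i.e. for each pair of vertices $u,v$ of $G$, if there is a path from $u$ to $v$ in $G$, then the longest path from $u$ to $v$ is unique. Then the length of the longest path from $s$ to $t$ in $G$ can be computed in $\mathrm{UL} \cap \mathrm{co\text{-}UL}$.
   Context: Graphs are finite, directed and unweighted; the length of a path is its number of edges. A source is a vertex of in-degree $0$, a sink is a vertex of out-degree $0$. $\mathrm{UL}$ (unambiguous logspace) is the class of languages accepted by a nondeterministic logarithmic-space Turing machine that has at most one accepting computation path on every input; $\mathrm{co\text{-}UL}$ is the class of complements of languages in $\mathrm{UL}$. That the length can be computed in $\mathrm{UL}\cap\mathrm{co\text{-}UL}$ is understood as follows: there is a single nondeterministic logarithmic-space Turing machine which, on every input $(G,s,t)$ satisfying the hypotheses, has exactly one computation path that does not reject, and on that path outputs the length of the longest path from $s$ to $t$ in $G$ (equivalently, on instances $(G,s,t,k)$ with $(G,s,t)$ satisfying the hypotheses, deciding whether the longest path from $s$ to $t$ has length at least $k$ is in $\mathrm{UL}\cap\mathrm{co\text{-}UL}$). *)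

theory Defs
  imports "Graph_Theory.Pair_Digraph" "HOL-Library.Landau_Symbols"
begin

section \<open>Longest paths in directed graphs\<close>

text \<open>The library cycles include loops.\<close>

definition dag :: "('a, 'b) pre_digraph \<Rightarrow> bool" where
  "dag G \<longleftrightarrow> fin_digraph G \<and> \<not> (\<exists>c. pre_digraph.cycle G c)"

definition unique_source :: "('a, 'b) pre_digraph \<Rightarrow> 'a \<Rightarrow> bool" where
  "unique_source G s \<longleftrightarrow> {v \<in> verts G. in_degree G v = 0} = {s}"

definition unique_sink :: "('a, 'b) pre_digraph \<Rightarrow> 'a \<Rightarrow> bool" where
  "unique_sink G t \<longleftrightarrow> {v \<in> verts G. out_degree G v = 0} = {t}"

definition longest_path :: "('a, 'b) pre_digraph \<Rightarrow> 'a \<Rightarrow> 'b list \<Rightarrow> 'a \<Rightarrow> bool" where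
  "longest_path G u p v \<longleftrightarrow>
     pre_digraph.apath G u p v \<and> (\<forall>q. pre_digraph.apath G u q v \<longrightarrow> length q \<le> length p)"

definition max_unique :: "('a, 'b) pre_digraph \<Rightarrow> bool" where
  "max_unique G \<longleftrightarrow>
     (\<forall>u \<in> verts G. \<forall>v \<in> verts G.
        (\<exists>p. pre_digraph.apath G u p v) \<longrightarrow> (\<exists>!p. longest_path G u p v))"

definition longest_path_length :: "('a, 'b) pre_digraph \<Rightarrow> 'a \<Rightarrow> 'a \<Rightarrow> nat" where
  "longest_path_length G u v = Max (length ` {p. pre_digraph.apath G u p v})"


section \<open>Nondeterministic Turing machines with output\<close>

text \<open>
  A machine has a two-way read-only input tape over \<open>{0,1}\<close>, delimited by the end markers
  \<open>Lend\<close> and \<open>Rend\<close>, a fixed number of two-way infinite work tapes, and a write-only,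
  one-way output tape over \<open>{0,1}\<close>.  States and work symbols are initial segments of the naturals,
  the work symbol \<open>0\<close> being the blank.  An action consists of the successor state, the move of the
  input head, for each work tape the symbol written and the move of its head, and the bit appended
  to the output, if any.
\<close>

datatype inp = Lend | Rend | Bit bool

datatype dir = Left | Stay | Right

type_synonym action = "nat \<times> dir \<times> (nat \<times> dir) list \<times> bool option"

record ntm =
  num_tapes :: nat
  num_symbols :: nat
  num_states :: nat
  start :: nat
  accept :: nat
  delta :: "nat \<Rightarrow> inp \<Rightarrow> nat list \<Rightarrow> action set"

text \<open>
  Input heads stay between the end markers and the accepting state is a halting state.
  Boundedness of the actions makes every \<open>delta M q x ys\<close> finite.
\<close>

definition wf_ntm :: "ntm \<Rightarrow> bool" where
  "wf_ntm M \<longleftrightarrow>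
     0 < num_symbols M \<and> start M < num_states M \<and> accept M < num_states M \<and>
     (\<forall>q x ys q' d ws ob. (q', d, ws, ob) \<in> delta M q x ys \<longrightarrow>
        q \<noteq> accept M \<and> q' < num_states M \<and>
        length ws = num_tapes M \<and> (\<forall>(y, e) \<in> set ws. y < num_symbols M) \<and>
        (x = Lend \<longrightarrow> d \<noteq> Left) \<and> (x = Rend \<longrightarrow> d \<noteq> Right))"

record config =
  state :: nat
  inpos :: nat
  work :: "((int \<Rightarrow> nat) \<times> int) list"
  written :: "bool list"

definition init_config :: "ntm \<Rightarrow> config" where
  "init_config M =
     \<lparr>state = start M, inpos = 0, work = replicate (num_tapes M) (\<lambda>_. 0, 0), written = []\<rparr>"

definition input_cell :: "bool list \<Rightarrow> nat \<Rightarrow> inp" where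
  "input_cell w i =
     (if i = 0 then Lend else if i \<le> length w then Bit (w ! (i - 1)) else Rend)"

fun move_input :: "dir \<Rightarrow> nat \<Rightarrow> nat" where
  "move_input Left i = i - 1"
| "move_input Stay i = i"
| "move_input Right i = i + 1"

fun offset :: "dir \<Rightarrow> int" where
  "offset Left = - 1"
| "offset Stay = 0"
| "offset Right = 1"

fun update_tape :: "nat \<times> dir \<Rightarrow> (int \<Rightarrow> nat) \<times> int \<Rightarrow> (int \<Rightarrow> nat) \<times> int" where
  "update_tape (y, d) (f, p) = (f(p := y), p + offset d)"

definition step :: "ntm \<Rightarrow> bool list \<Rightarrow> config \<Rightarrow> config \<Rightarrow> bool" where
  "step M w c c' \<longleftrightarrow>
     (\<exists>q d ws ob.
        (q, d, ws, ob) \<in> delta M (state c) (input_cell w (inpos c)) (map (\<lambda>(f, p). f p) (work c)) \<and>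
        c' = \<lparr>state = q, inpos = move_input d (inpos c), work = map2 update_tape ws (work c),
              written = written c @ (case ob of None \<Rightarrow> [] | Some b \<Rightarrow> [b])\<rparr>)"

definition computation :: "ntm \<Rightarrow> bool list \<Rightarrow> config list \<Rightarrow> bool" where
  "computation M w cs \<longleftrightarrow> cs \<noteq> [] \<and> hd cs = init_config M \<and> successively (step M w) cs"

definition infinite_computation :: "ntm \<Rightarrow> bool list \<Rightarrow> (nat \<Rightarrow> config) \<Rightarrow> bool" where
  "infinite_computation M w f \<longleftrightarrow> f 0 = init_config M \<and> (\<forall>i. step M w (f i) (f (Suc i)))"

text \<open>
  A computation path that gets stuck in a state other than the accepting one rejects.
\<close>

definition accepting :: "ntm \<Rightarrow> bool list \<Rightarrow> config list \<Rightarrow> bool" where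
  "accepting M w cs \<longleftrightarrow> computation M w cs \<and> state (last cs) = accept M"

text \<open>Pairs of a work tape and a cell of it that is scanned during a computation.\<close>

definition scanned_cells :: "config list \<Rightarrow> (nat \<times> int) set" where
  "scanned_cells cs = {(i, snd (work c ! i)) | c i. c \<in> set cs \<and> i < length (work c)}"

definition logspace :: "ntm \<Rightarrow> bool" where
  "logspace M \<longleftrightarrow>
     (\<exists>s :: nat \<Rightarrow> nat. (\<lambda>n. real (s n)) \<in> O(\<lambda>n. ln (real n)) \<and>
        (\<forall>w cs. computation M w cs \<longrightarrow> card (scanned_cells cs) \<le> s (length w)))"


section \<open>Functions computable in UL and co-UL\<close>

fun binary :: "nat \<Rightarrow> bool list" where
  "binary n = (if n < 2 then [n = 1] else binary (n div 2) @ [odd n])"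

declare binary.simps [simp del]

text \<open>
  A single nondeterministic logspace machine has, on the encoding \<open>enc x\<close> of every \<open>x\<close> in the promise
  set \<open>P\<close>, exactly one computation path that does not reject, and on that path outputs \<open>f x\<close> in
  binary.  An infinite path does not reject, so it is excluded explicitly; the space bound is
  required on all inputs.
\<close>

definition computable_in_UL_coUL :: "'a set \<Rightarrow> ('a \<Rightarrow> bool list) \<Rightarrow> ('a \<Rightarrow> nat) \<Rightarrow> bool" where
  "computable_in_UL_coUL P enc f \<longleftrightarrow>
     (\<exists>M. wf_ntm M \<and> logspace M \<and>
        (\<forall>x \<in> P.
           \<not> (\<exists>g. infinite_computation M (enc x) g) \<and>
           (\<exists>!cs. accepting M (enc x) cs) \<and>
           (\<forall>cs. accepting M (enc x) cs \<longrightarrow> written (last cs) = binary (f x))))"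


section \<open>Encoding of instances\<close>

text \<open>
  Graphs without parallel arcs on the vertex set \<open>{..<n}\<close> are encoded by \<open>n\<close>, \<open>s\<close>, \<open>t\<close> in unary,
  each terminated by a \<open>0\<close>, followed by the adjacency matrix in row-major order.
\<close>

type_synonym inst = "nat pair_pre_digraph \<times> nat \<times> nat"

definition unary :: "nat \<Rightarrow> bool list" where
  "unary n = replicate n True @ [False]"

definition adjacency_matrix :: "nat \<Rightarrow> (nat \<times> nat) set \<Rightarrow> bool list" where
  "adjacency_matrix n E = [(u, v) \<in> E. u \<leftarrow> [0..<n], v \<leftarrow> [0..<n]]"

fun encode :: "inst \<Rightarrow> bool list" where
  "encode (G, s, t) =
     (let n = card (pverts G)
      in unary n @ unary s @ unary t @ adjacency_matrix n (parcs G))"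

definition max_unique_instances :: "inst set" where
  "max_unique_instances =
     {(G, s, t). pverts G = {..<card (pverts G)} \<and> dag (with_proj G) \<and>
        unique_source (with_proj G) s \<and> unique_sink (with_proj G) t \<and>
        max_unique (with_proj G)}"

end

theory Submission
  imports Defs "HOL-Library.Countable_Set"
begin

text \<open>
  In a max-unique graph with a unique source every vertex \<open>y\<close> is the end of a unique longest walk; let
  \<open>D y\<close> be its length.  The machine guesses \<open>T = \<Sum>y. D y\<close> and then computes, for
  \<open>k = 0, 1, \<dots>\<close>, the sums \<open>M k = \<Sum>y. min (D y) k\<close>.  To learn which vertices have
  \<open>D y \<ge> k\<close> it guesses for every \<open>y\<close> a walk ending at \<open>y\<close>, of length \<open>l y\<close> say, and rejects
  unless \<open>\<Sum>y. min (l y) k = M k\<close> and \<open>\<Sum>y. l y \<ge> T\<close>.  The first test forces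
  \<open>min (l y) k = min (D y) k\<close> for all \<open>y\<close>, so the information obtained is right even if \<open>T\<close> was guessed
  too small; if \<open>T\<close> is right, the second test leaves a single choice of the walks.  Since
  \<open>D x \<ge> k + 1\<close> if and only if \<open>D z \<ge> k\<close> for some predecessor \<open>z\<close> of \<open>x\<close>, this yields
  \<open>M (k + 1)\<close>.  The sums become stationary at \<open>k = max D\<close>, which is \<open>D t\<close> because every walk extends
  to the unique sink \<open>t\<close>, and the final value is \<open>\<Sum>y. D y\<close>, so that a wrong \<open>T\<close> is detected.
\<close>

section \<open>Counting accepting computation paths\<close>

text \<open>Inductive counting for shortest walks can check a level by sums restricted to that
  level, because the shortest walk to be guessed is itself of bounded length. For longest walks this
  fails: a vertex \<open>y\<close> with \<open>D y \<ge> k\<close> may end many walks of length at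
  least \<open>k\<close>, and only the full longest walk is unique. Uniqueness of the guesses thus
  depends on the sum of all full lengths, which is known only after the last level; this is why it
  is guessed beforehand. Too large a guess lets no choice of walks pass. Too small a guess may let
  several pass, but all of them arrive at the same final sum and are rejected there. Uniqueness
  among all walks ending at \<open>y\<close>, whatever their first vertex, comes from the source: a
  longest such walk cannot be extended backwards, so it starts at \<open>s\<close>. The formal
  argument is a count of accepting executions, which is additive over guesses and has to come out as
  1.\<close>

inductive paths :: "ntm \<Rightarrow> bool list \<Rightarrow> bool list \<Rightarrow> config \<Rightarrow> nat \<Rightarrow> bool"
  for M w out where
  paths_accept: "paths M w out c 1" if "state c = accept M" "written c = out"
| paths_stuck: "paths M w out c 0" if "state c \<noteq> accept M" "\<And>z. \<not> step M w c z"
| paths_step: "paths M w out c m"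
    if "state c \<noteq> accept M" "\<And>z. step M w c z \<longleftrightarrow> z = y" "paths M w out y m"
| paths_fork: "paths M w out c (m1 + m2)"
    if "state c \<noteq> accept M" "\<And>z. step M w c z \<longleftrightarrow> z = y1 \<or> z = y2" "y1 \<noteq> y2"
      "paths M w out y1 m1" "paths M w out y2 m2"

lemma no_step_accept:
  assumes "wf_ntm M" "state c = accept M"
  shows "\<not> step M w c z"
  using assms unfolding wf_ntm_def step_def by blast

text \<open>The rules of \<open>paths\<close> descend to every successor, so a derivation is a
  finite tree containing all continuations of \<open>c\<close>; an infinite computation would have
  to run through it without meeting a leaf.\<close>

lemma paths_terminates:
  assumes "paths M w out c m" "wf_ntm M" "g 0 = c" "\<And>i. step M w (g i) (g (Suc i))"
  shows False
  using assms
proof (induction arbitrary: g rule: paths.induct)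
  case (paths_accept c)
  then show ?case using no_step_accept by metis
next
  case (paths_stuck c)
  then show ?case by metis
next
  case (paths_step c y m)
  have "g (Suc 0) = y" using paths_step by metis
  then show ?case using paths_step.IH[of "\<lambda>i. g (Suc i)"] paths_step.prems by simp
next
  case (paths_fork c y1 y2 m1 m2)
  have "g (Suc 0) = y1 \<or> g (Suc 0) = y2" using paths_fork by metis
  then show ?case
    using paths_fork.IH(1)[of "\<lambda>i. g (Suc i)"] paths_fork.IH(2)[of "\<lambda>i. g (Suc i)"]
      paths_fork.prems by auto
qed

definition accepting_from :: "ntm \<Rightarrow> bool list \<Rightarrow> config \<Rightarrow> config list \<Rightarrow> bool" where
  "accepting_from M w c cs \<longleftrightarrow>
     cs \<noteq> [] \<and> hd cs = c \<and> successively (step M w) cs \<and> state (last cs) = accept M"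

lemma accepting_from_accept:
  assumes "wf_ntm M" "state c = accept M"
  shows "accepting_from M w c cs \<longleftrightarrow> cs = [c]"
proof
  assume a: "accepting_from M w c cs"
  then obtain ds where "cs = c # ds" unfolding accepting_from_def by (cases cs) auto
  with a show "cs = [c]"
    using no_step_accept[OF assms] unfolding accepting_from_def by (cases ds) auto
qed (use assms in \<open>auto simp: accepting_from_def\<close>)

lemma accepting_from_step:
  assumes "state c \<noteq> accept M"
  shows "accepting_from M w c cs \<longleftrightarrow>
    (\<exists>z ds. step M w c z \<and> cs = c # ds \<and> accepting_from M w z ds)" (is "?l = ?r")
proof
  assume a: ?l
  then obtain ds where ds: "cs = c # ds" unfolding accepting_from_def by (cases cs) auto
  with a show ?r using assms unfolding accepting_from_def by (cases ds) auto
next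
  assume ?r
  then show ?l unfolding accepting_from_def by (auto simp: successively_Cons)
qed

text \<open>Only the counts 0 and 1 have to be interpreted, and the fork rule stays within them: a
  sum equal to 1 splits into 0 and 1.\<close>

lemma paths_count:
  assumes "paths M w out c m" "wf_ntm M"
  shows "accepting_from M w c cs \<Longrightarrow> written (last cs) = out"
    and "m = 0 \<Longrightarrow> \<not> accepting_from M w c cs"
    and "m = 1 \<Longrightarrow> \<exists>!cs. accepting_from M w c cs"
proof -
  have "(\<forall>cs. accepting_from M w c cs \<longrightarrow> written (last cs) = out) \<and>
        (m = 0 \<longrightarrow> (\<forall>cs. \<not> accepting_from M w c cs)) \<and>
        (m = 1 \<longrightarrow> (\<exists>!cs. accepting_from M w c cs))"
    using assms
  proof (induction rule: paths.induct)
    case (paths_accept c)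
    then show ?case by (simp add: accepting_from_accept)
  next
    case (paths_stuck c)
    then show ?case by (simp add: accepting_from_step)
  next
    case (paths_step c y m)
    have eq: "accepting_from M w c cs \<longleftrightarrow> (\<exists>ds. cs = c # ds \<and> accepting_from M w y ds)" for cs
      using paths_step.hyps(1,2) by (subst accepting_from_step) auto
    have ne: "accepting_from M w y ds \<Longrightarrow> ds \<noteq> []" for ds by (simp add: accepting_from_def)
    have IH: "accepting_from M w y ds \<Longrightarrow> written (last ds) = out"
      "m = 0 \<Longrightarrow> \<not> accepting_from M w y ds" "m = 1 \<Longrightarrow> \<exists>!ds. accepting_from M w y ds" for ds
      using paths_step.IH paths_step.prems by auto
    have u: "m = 1 \<Longrightarrow> \<exists>!cs. accepting_from M w c cs"
      unfolding eq using IH(3) by (metis list.inject)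
    show ?case using IH(1,2) ne u unfolding eq by auto
  next
    case (paths_fork c y1 y2 m1 m2)
    have eq: "accepting_from M w c cs \<longleftrightarrow>
        (\<exists>ds. cs = c # ds \<and> (accepting_from M w y1 ds \<or> accepting_from M w y2 ds))" for cs
      using paths_fork.hyps(1,2) by (subst accepting_from_step) auto
    have ne: "accepting_from M w y ds \<Longrightarrow> ds \<noteq> []" for y ds by (simp add: accepting_from_def)
    have IH: "m1 = 0 \<Longrightarrow> \<not> accepting_from M w y1 cs" "m2 = 0 \<Longrightarrow> \<not> accepting_from M w y2 cs" 
      "m1 = 1 \<Longrightarrow> \<exists>!cs. accepting_from M w y1 cs" "m2 = 1 \<Longrightarrow> \<exists>!cs. accepting_from M w y2 cs" 
      for cs using paths_fork by auto
    have "(m1 = 0 \<and> m2 = 1) \<or> (m1 = 1 \<and> m2 = 0)" if "m1 + m2 = 1" using that by arith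
    then have "\<exists>!ds. accepting_from M w y1 ds \<or> accepting_from M w y2 ds" if "m1 + m2 = 1"
      using that IH by (metis (no_types))
    then have u: "m1 + m2 = 1 \<Longrightarrow> \<exists>!cs. accepting_from M w c cs"
      unfolding eq by (metis list.inject)
    have w: "accepting_from M w y1 ds \<or> accepting_from M w y2 ds \<Longrightarrow> written (last ds) = out" for ds
      using paths_fork.IH paths_fork.prems by auto
    show ?case using u IH(1,2) ne w unfolding eq by auto
  qed
  then show "accepting_from M w c cs \<Longrightarrow> written (last cs) = out"
    and "m = 0 \<Longrightarrow> \<not> accepting_from M w c cs"
    and "m = 1 \<Longrightarrow> \<exists>!cs. accepting_from M w c cs" by auto
qed

lemma paths_unique:
  assumes "paths M w out (init_config M) 1" "wf_ntm M"
  shows "\<not> (\<exists>g. infinite_computation M w g)" "\<exists>!cs. accepting M w cs"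
    "accepting M w cs \<Longrightarrow> written (last cs) = out"
proof -
  have eq: "accepting M w = accepting_from M w (init_config M)"
    by (auto simp: accepting_def computation_def accepting_from_def)
  show "\<not> (\<exists>g. infinite_computation M w g)"
    using paths_terminates[OF assms] by (auto simp: infinite_computation_def)
  show "\<exists>!cs. accepting M w cs" "accepting M w cs \<Longrightarrow> written (last cs) = out"
    unfolding eq using paths_count[OF assms] by auto
qed

section \<open>A register language\<close>

datatype 'r sweep = Clear 'r | Incr 'r | Plus 'r 'r | Less 'r 'r | Emit 'r

datatype 'r atom = Sweep "'r sweep" | Look "inp \<Rightarrow> dir \<times> bool \<times> bool option"

text \<open>Each atom is an action and a test at once, so a plain statement is a \<open>Cond\<close>
  with two equal branches. \<open>Star\<close>, an arbitrary number of repetitions, is the only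
  source of nondeterminism.\<close>

datatype 'r com =
  Skip | Fail | Seq "'r com" "'r com" | Cond "'r atom" "'r com" "'r com"
| Loop "'r atom" "'r com" | Star "'r com"

text \<open>A point of control is the list of commands that remain to be executed.\<close>

datatype 'r instr =
  Halt | Abort | Goto "'r com list" | Fork "'r com list" "'r com list"
| Test "'r atom" "'r com list" "'r com list"

fun node :: "'r com list \<Rightarrow> 'r instr" where
  "node [] = Halt"
| "node (Skip # K) = Goto K"
| "node (Fail # K) = Abort"
| "node (Seq a b # K) = Goto (a # b # K)"
| "node (Cond t a b # K) = Test t (a # K) (b # K)"
| "node (Loop t a # K) = Test t (a # Loop t a # K) K"
| "node (Star a # K) = Fork K (a # Star a # K)"

type_synonym 'r valuation = "('r \<Rightarrow> nat) \<times> nat \<times> bool list"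

fun option_list :: "'a option \<Rightarrow> 'a list" where
  "option_list None = []"
| "option_list (Some b) = [b]"

definition clamp :: "inp \<Rightarrow> dir \<Rightarrow> dir" where
  "clamp x d = (if x = Lend \<and> d = Left \<or> x = Rend \<and> d = Right then Stay else d)"

fun sweep_sem :: "nat \<Rightarrow> 'r sweep \<Rightarrow> ('r \<Rightarrow> nat) \<Rightarrow> bool \<times> ('r \<Rightarrow> nat) \<times> bool list" where
  "sweep_sem L (Clear r) \<rho> = (False, \<rho>(r := 0), [])"
| "sweep_sem L (Incr r) \<rho> = (Suc (\<rho> r) < 2 ^ L, \<rho>(r := Suc (\<rho> r) mod 2 ^ L), [])"
| "sweep_sem L (Plus r r') \<rho> = (2 ^ L \<le> \<rho> r + \<rho> r', \<rho>(r := (\<rho> r + \<rho> r') mod 2 ^ L), [])"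
| "sweep_sem L (Less r r') \<rho> = (\<rho> r < \<rho> r', \<rho>, [])"
| "sweep_sem L (Emit r) \<rho> = (0 < \<rho> r, \<rho>, if 0 < \<rho> r then binary (\<rho> r) else [])"

fun exec :: "bool list \<Rightarrow> nat \<Rightarrow> 'r atom \<Rightarrow> 'r valuation \<Rightarrow> bool \<times> 'r valuation" where
  "exec w L (Sweep s) (\<rho>, h, o') =
     (case sweep_sem L s \<rho> of (b, \<rho>', e) \<Rightarrow> (b, \<rho>', h, o' @ e))"
| "exec w L (Look g) (\<rho>, h, o') =
     (case g (input_cell w h) of (d, b, ob) \<Rightarrow>
        (b, \<rho>, move_input (clamp (input_cell w h) d) h, o' @ option_list ob))"

text \<open>The counterpart of \<open>paths\<close> one level up: \<open>m\<close> counts the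
  accepting executions, and a derivation certifies termination. \<open>L\<close> is the number of
  bits of a register.\<close>

inductive runs :: "bool list \<Rightarrow> nat \<Rightarrow> bool list \<Rightarrow> 'r com list \<Rightarrow> 'r valuation \<Rightarrow> nat \<Rightarrow> bool"
  for w L out where
  runs_halt: "runs w L out l (\<rho>, h, out) 1" if "node l = Halt"
| runs_abort: "runs w L out l \<sigma> 0" if "node l = Abort"
| runs_goto: "runs w L out l \<sigma> m" if "node l = Goto l'" "runs w L out l' \<sigma> m"
| runs_fork: "runs w L out l \<sigma> (m1 + m2)"
    if "node l = Fork l1 l2" "runs w L out l1 \<sigma> m1" "runs w L out l2 \<sigma> m2"
| runs_test: "runs w L out l \<sigma> m"
    if "node l = Test a l1 l2" "exec w L a \<sigma> = (b, \<sigma>')" "runs w L out (if b then l1 else l2) \<sigma>' m"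

section \<open>Registers as tracks of a tape\<close>

text \<open>
  A symbol is a column of bits, one for each register; column \<open>i\<close> consists of the bits of weight
  \<open>2\<^sup>i\<close>.  An operation is a finite-state sweep from the least to the most significant column and
  back.
\<close>

fun fwd_step :: "'r sweep \<Rightarrow> bool \<Rightarrow> ('r \<Rightarrow> bool) \<Rightarrow> bool \<times> ('r \<Rightarrow> bool)" where
  "fwd_step (Clear r) b c = (b, c(r := False))"
| "fwd_step (Incr r) b c = (if b then (b, c) else (\<not> c r, c(r := \<not> c r)))"
| "fwd_step (Plus r r') b c = (c r \<and> c r' \<or> b \<and> (c r \<or> c r'), c(r := ((c r \<noteq> c r') \<noteq> b)))"
| "fwd_step (Less r r') b c = (if c r = c r' then b else c r', c)"
| "fwd_step (Emit r) b c = (b, c)"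

fun bwd_step :: "'r sweep \<Rightarrow> bool \<Rightarrow> ('r \<Rightarrow> bool) \<Rightarrow> bool \<times> bool option" where
  "bwd_step (Emit r) b c = (b \<or> c r, if b \<or> c r then Some (c r) else None)"
| "bwd_step s b c = (b, None)"

fun fwd :: "'r sweep \<Rightarrow> bool \<Rightarrow> ('r \<Rightarrow> bool) list \<Rightarrow> bool \<times> ('r \<Rightarrow> bool) list" where
  "fwd s b [] = (b, [])"
| "fwd s b (c # cs) =
     (case fwd_step s b c of (b', c') \<Rightarrow> case fwd s b' cs of (b'', cs') \<Rightarrow> (b'', c' # cs'))"

fun bwd :: "'r sweep \<Rightarrow> bool \<Rightarrow> ('r \<Rightarrow> bool) list \<Rightarrow> bool \<times> bool list" where
  "bwd s b [] = (b, [])"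
| "bwd s b (c # cs) =
     (case bwd s b cs of (b', e) \<Rightarrow> case bwd_step s b' c of (b'', ob) \<Rightarrow> (b'', e @ option_list ob))"

fun columns :: "nat \<Rightarrow> ('r \<Rightarrow> nat) \<Rightarrow> ('r \<Rightarrow> bool) list" where
  "columns 0 \<rho> = []"
| "columns (Suc L) \<rho> = (\<lambda>r. odd (\<rho> r)) # columns L (\<lambda>r. \<rho> r div 2)"

lemma length_columns [simp]: "length (columns L \<rho>) = L"
  by (induction L arbitrary: \<rho>) auto

lemma columns_upd:
  "columns (Suc L) (\<rho>(r := v)) =
     (\<lambda>x. odd (\<rho> x))(r := odd v) # columns L ((\<lambda>x. \<rho> x div 2)(r := v div 2))"
proof -
  have "(\<lambda>x. (\<rho>(r := v)) x div 2) = (\<lambda>x. \<rho> x div 2)(r := v div 2)"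
    "(\<lambda>x. odd ((\<rho>(r := v)) x)) = (\<lambda>x. odd (\<rho> x))(r := odd v)" by auto
  then show ?thesis by (simp only: columns.simps)
qed

text \<open>Columns do not see a carry out of the top bit; for this reason \<open>sweep_sem\<close>
  reduces modulo \<open>2 ^ L\<close>.\<close>

lemma columns_mod: "columns L (\<rho>(r := v mod 2 ^ L)) = columns L (\<rho>(r := v))"
proof (induction L arbitrary: \<rho> v)
  case (Suc L)
  have "v mod 2 ^ Suc L div 2 = v div 2 mod 2 ^ L"
    by (simp add: mod_mult2_eq)
  moreover have "odd (v mod 2 ^ Suc L) = odd v"
    by (simp add: mod_mult2_eq)
  ultimately show ?case
    unfolding columns_upd by (simp only: Suc)
qed simp

lemma fwd_Clear: "fwd (Clear r) b (columns L \<rho>) = (b, columns L (\<rho>(r := 0)))"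
proof (induction L arbitrary: \<rho>)
  case (Suc L)
  show ?case unfolding columns_upd by (simp add: Suc del: fun_upd_apply)
qed simp

lemma fwd_Incr_True: "fwd (Incr r) True cs = (True, cs)"
  by (induction cs) auto

text \<open>The flag \<open>True\<close> means that the carry has been absorbed. The sweep starts
  with the carry pending, so the final flag reports the absence of overflow.\<close>

lemma fwd_Incr:
  "\<rho> r < 2 ^ L \<Longrightarrow>
   fwd (Incr r) False (columns L \<rho>) = (Suc (\<rho> r) < 2 ^ L, columns L (\<rho>(r := Suc (\<rho> r))))"
proof (induction L arbitrary: \<rho>)
  case (Suc L)
  show ?case
  proof (cases "odd (\<rho> r)")
    case True
    have lt: "\<rho> r div 2 < 2 ^ L" using Suc.prems by auto
    have d: "Suc (\<rho> r) div 2 = Suc (\<rho> r div 2)" using True by presburger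
    have "Suc (\<rho> r div 2) < 2 ^ L \<longleftrightarrow> Suc (\<rho> r) < 2 ^ Suc L" using True by (auto elim!: oddE)
    then show ?thesis
      using Suc.IH[of "\<lambda>x. \<rho> x div 2"] True lt
      unfolding columns_upd d by (simp del: fun_upd_apply)
  next
    case False
    have d: "Suc (\<rho> r) div 2 = \<rho> r div 2" "Suc (\<rho> r) < 2 ^ Suc L"
      using False Suc.prems by (auto elim!: evenE)
    have "(\<lambda>x. \<rho> x div 2)(r := \<rho> r div 2) = (\<lambda>x. \<rho> x div 2)" by auto
    then show ?thesis
      using False d(2) unfolding columns_upd d(1) by (simp add: fwd_Incr_True del: fun_upd_apply)
  qed
qed simp

lemma fwd_Plus:
  "\<rho> r < 2 ^ L \<Longrightarrow> \<rho> r' < 2 ^ L \<Longrightarrow>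
   fwd (Plus r r') b (columns L \<rho>) =
     (2 ^ L \<le> \<rho> r + \<rho> r' + of_bool b, columns L (\<rho>(r := \<rho> r + \<rho> r' + of_bool b)))"
proof (induction L arbitrary: \<rho> b)
  case (Suc L)
  define b' where "b' \<longleftrightarrow> odd (\<rho> r) \<and> odd (\<rho> r') \<or> b \<and> (odd (\<rho> r) \<or> odd (\<rho> r'))"
  let ?s = "\<rho> r div 2 + \<rho> r' div 2 + of_bool b'"
  have lt: "\<rho> r div 2 < 2 ^ L" "\<rho> r' div 2 < 2 ^ L" using Suc.prems by auto
  have s: "?s = (\<rho> r + \<rho> r' + of_bool b) div 2"
    unfolding b'_def
    by (cases b; cases "odd (\<rho> r)"; cases "odd (\<rho> r')") (auto elim!: oddE evenE)
  have o: "odd (\<rho> r + \<rho> r' + of_bool b) \<longleftrightarrow> ((odd (\<rho> r) \<noteq> odd (\<rho> r')) \<noteq> b)"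
    by auto
  have "2 ^ L \<le> ?s \<longleftrightarrow> 2 ^ Suc L \<le> \<rho> r + \<rho> r' + of_bool b"
    unfolding s by auto
  then show ?case
    using Suc.IH[of "\<lambda>x. \<rho> x div 2" b'] lt
    unfolding columns_upd o unfolding s by (simp add: b'_def del: fun_upd_apply)
qed simp

text \<open>The most significant column in which the registers differ decides, and the sweep meets
  it last; the flag is the comparison of the lower columns and is overwritten at each
  difference.\<close>

lemma fwd_Less:
  "\<rho> r < 2 ^ L \<Longrightarrow> \<rho> r' < 2 ^ L \<Longrightarrow>
   fwd (Less r r') b (columns L \<rho>) = (\<rho> r < \<rho> r' \<or> \<rho> r = \<rho> r' \<and> b, columns L \<rho>)"
proof (induction L arbitrary: \<rho> b)
  case (Suc L)
  define b' where "b' \<longleftrightarrow> odd (\<rho> r) = odd (\<rho> r') \<and> b \<or> even (\<rho> r) \<and> odd (\<rho> r')"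
  have lt: "\<rho> r div 2 < 2 ^ L" "\<rho> r' div 2 < 2 ^ L" using Suc.prems by auto
  have "(\<rho> r div 2 < \<rho> r' div 2 \<or> \<rho> r div 2 = \<rho> r' div 2 \<and> b') \<longleftrightarrow>
      (\<rho> r < \<rho> r' \<or> \<rho> r = \<rho> r' \<and> b)"
    unfolding b'_def by (cases b; presburger)
  then show ?case
    using Suc.IH[of "\<lambda>x. \<rho> x div 2" b'] lt by (auto simp: b'_def)
qed simp

lemma fwd_Emit: "fwd (Emit r) b cs = (b, cs)"
  by (induction cs) auto

text \<open>The backward pass meets the top bit first. Its flag turns true at the first bit 1, which
  suppresses leading zeros; for the value 0 nothing is written, and the flag tells the program
  so.\<close>

lemma bwd_Emit:
  "\<rho> r < 2 ^ L \<Longrightarrow>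
   bwd (Emit r) False (columns L \<rho>) = (0 < \<rho> r, if 0 < \<rho> r then binary (\<rho> r) else [])"
proof (induction L arbitrary: \<rho>)
  case (Suc L)
  have "\<rho> r div 2 < 2 ^ L" using Suc.prems by auto
  then have IH: "bwd (Emit r) False (columns L (\<lambda>x. \<rho> x div 2)) =
      (0 < \<rho> r div 2, if 0 < \<rho> r div 2 then binary (\<rho> r div 2) else [])"
    using Suc.IH by simp
  consider "\<rho> r = 0" | "\<rho> r = 1" | "2 \<le> \<rho> r" by linarith
  then show ?case
  proof cases
    case 3
    then have "0 < \<rho> r div 2" by linarith
    with 3 show ?thesis using IH by (simp add: binary.simps[of "\<rho> r"])
  qed (use IH in \<open>simp_all add: binary.simps[of "Suc 0"]\<close>)
qed simp

lemma bwd_silent: "(\<And>r. s \<noteq> Emit r) \<Longrightarrow> bwd s b cs = (b, [])"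
  by (induction cs) (cases s; auto)+

text \<open>The forward flag \<open>b'\<close> is already the result, except for
  \<open>Emit\<close>, where the backward pass computes it. Either way the result is known when the
  head is back at the least significant column.\<close>

lemma sweep_columns:
  assumes "\<And>r. \<rho> r < 2 ^ L" "sweep_sem L s \<rho> = (b, \<rho>', e)"
  shows "\<exists>b'. fwd s False (columns L \<rho>) = (b', columns L \<rho>') \<and> bwd s b' (columns L \<rho>') = (b, e)"
  using assms
  by (cases s) (auto simp: fwd_Clear fwd_Incr fwd_Plus fwd_Less fwd_Emit bwd_Emit bwd_silent
      columns_mod)

lemma sweep_sem_bounded:
  assumes "\<And>r. \<rho> r < 2 ^ L" "sweep_sem L s \<rho> = (b, \<rho>', e)"
  shows "\<rho>' r < 2 ^ L"
  using assms by (cases s) auto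

section \<open>Compilation to a Turing machine with one work tape\<close>

datatype 'r mstate =
  Init | Carry | Return | Run "'r com list"
| Forth "'r sweep" bool "'r com list" "'r com list"
| Back "'r sweep" bool "'r com list" "'r com list"

type_synonym 'r symbol = "('r \<Rightarrow> bool) option"

text \<open>
  Before the program starts, the machine counts the cells of the input, including the left end
  marker, in binary on all tracks at once.  This lays out just enough columns.
\<close>

fun act :: "'r com \<Rightarrow> 'r mstate \<Rightarrow> inp \<Rightarrow> 'r symbol \<Rightarrow>
    ('r mstate \<times> dir \<times> 'r symbol \<times> dir \<times> bool option) set" where
  "act p Init x y =
     {if x = Rend then (Run [p], Stay, y, Stay, None) else (Carry, Right, y, Stay, None)}"
| "act p Carry x y =
     {if y = Some (\<lambda>_. True) then (Carry, Stay, Some (\<lambda>_. False), Right, None)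
      else (Return, Stay, Some (\<lambda>_. True), Left, None)}"
| "act p Return x y =
     {if y = None then (Init, Stay, y, Right, None) else (Return, Stay, y, Left, None)}"
| "act p (Run l) x y =
     (case node l of
        Halt \<Rightarrow> {}
      | Abort \<Rightarrow> {}
      | Goto l' \<Rightarrow> {(Run l', Stay, y, Stay, None)}
      | Fork l1 l2 \<Rightarrow> {(Run l1, Stay, y, Stay, None), (Run l2, Stay, y, Stay, None)}
      | Test a l1 l2 \<Rightarrow>
          (case a of
             Sweep s \<Rightarrow> {(Forth s False l1 l2, Stay, y, Stay, None)}
           | Look g \<Rightarrow>
               {case g x of (d, b, ob) \<Rightarrow> (Run (if b then l1 else l2), clamp x d, y, Stay, ob)}))"
| "act p (Forth s b l1 l2) x y =
     {case y of
        None \<Rightarrow> (Back s b l1 l2, Stay, y, Left, None)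
      | Some c \<Rightarrow> (Forth s (fst (fwd_step s b c)) l1 l2, Stay, Some (snd (fwd_step s b c)), Right, None)}"
| "act p (Back s b l1 l2) x y =
     {case y of
        None \<Rightarrow> (Run (if b then l1 else l2), Stay, y, Right, None)
      | Some c \<Rightarrow> (Back s (fst (bwd_step s b c)) l1 l2, Stay, y, Left, snd (bwd_step s b c))}"

text \<open>The stack of pending commands stays bounded because \<open>Loop\<close> and
  \<open>Star\<close> put a single copy of themselves below their body. \<open>K\<close> itself,
  reached when \<open>c\<close> is completed, is left out.\<close>

fun continuations :: "'r com \<Rightarrow> 'r com list \<Rightarrow> 'r com list set" where
  "continuations Skip K = {Skip # K}"
| "continuations Fail K = {Fail # K}"
| "continuations (Seq a b) K = insert (Seq a b # K) (continuations a (b # K) \<union> continuations b K)"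
| "continuations (Cond t a b) K = insert (Cond t a b # K) (continuations a K \<union> continuations b K)"
| "continuations (Loop t a) K = insert (Loop t a # K) (continuations a (Loop t a # K))"
| "continuations (Star a) K = insert (Star a # K) (continuations a (Star a # K))"

fun targets :: "'r instr \<Rightarrow> 'r com list set" where
  "targets Halt = {}"
| "targets Abort = {}"
| "targets (Goto l) = {l}"
| "targets (Fork l1 l2) = {l1, l2}"
| "targets (Test a l1 l2) = {l1, l2}"

lemma finite_continuations: "finite (continuations c K)"
  by (induction c arbitrary: K) auto

lemma Cons_in_continuations: "c # K \<in> continuations c K"
  by (cases c) auto

lemma targets_continuations:
  "l \<in> continuations c K \<Longrightarrow> targets (node l) \<subseteq> insert K (continuations c K)"
proof (induction c arbitrary: K)
  case (Seq a b)
  then show ?case using Cons_in_continuations by fastforce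
next
  case (Cond t a b)
  then show ?case using Cons_in_continuations by fastforce
next
  case (Loop t a)
  then show ?case using Cons_in_continuations by fastforce
next
  case (Star a)
  then show ?case using Cons_in_continuations by fastforce
qed auto

definition points :: "'r com \<Rightarrow> 'r com list set" where
  "points p = insert [] (continuations p [])"

lemma targets_points: "l \<in> points p \<Longrightarrow> targets (node l) \<subseteq> points p"
  using targets_continuations[of l p "[]"] by (auto simp: points_def)

lemma start_in_points: "[p] \<in> points p"
  using Cons_in_continuations[of p "[]"] by (simp add: points_def)

fun sweep_states :: "'r instr \<Rightarrow> 'r mstate set" where
  "sweep_states (Test (Sweep s) l1 l2) =
     {Forth s True l1 l2, Forth s False l1 l2, Back s True l1 l2, Back s False l1 l2}"
| "sweep_states _ = {}"

text \<open>The type \<open>mstate\<close> is infinite, while the states of a machine form an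
  initial segment of the naturals. This finite set is closed under \<open>act\<close> and is
  enumerated by \<open>code\<close>.\<close>

definition states :: "'r com \<Rightarrow> 'r mstate set" where
  "states p = {Init, Carry, Return} \<union> Run ` points p \<union> (\<Union>l\<in>points p. sweep_states (node l))"

lemma finite_states: "finite (states p)"
proof -
  have "finite (sweep_states i)" for i :: "'a instr"
    by (cases i rule: sweep_states.cases) auto
  then show ?thesis by (auto simp: states_def points_def finite_continuations)
qed

lemma Run_in_states: "Run l \<in> states p \<longleftrightarrow> l \<in> points p"
proof -
  have "Run l \<notin> sweep_states i" for i :: "'a instr"
    by (cases i rule: sweep_states.cases) auto
  then show ?thesis by (auto simp: states_def)
qed

lemma sweep_state_in_states:
  "Forth s b l1 l2 \<in> states p \<longleftrightarrow> (\<exists>l\<in>points p. node l = Test (Sweep s) l1 l2)"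
  "Back s b l1 l2 \<in> states p \<longleftrightarrow> (\<exists>l\<in>points p. node l = Test (Sweep s) l1 l2)"
proof -
  have "Forth s b l1 l2 \<in> sweep_states i \<longleftrightarrow> i = Test (Sweep s) l1 l2"
    "Back s b l1 l2 \<in> sweep_states i \<longleftrightarrow> i = Test (Sweep s) l1 l2" for i
    by (cases i rule: sweep_states.cases; cases b; auto)+
  then show "Forth s b l1 l2 \<in> states p \<longleftrightarrow> (\<exists>l\<in>points p. node l = Test (Sweep s) l1 l2)"
    "Back s b l1 l2 \<in> states p \<longleftrightarrow> (\<exists>l\<in>points p. node l = Test (Sweep s) l1 l2)"
    by (auto simp: states_def)
qed

lemma act_states:
  assumes "q \<in> states p" "(q', d, y', e, ob) \<in> act p q x y"
  shows "q' \<in> states p"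
proof (cases q)
  case Init
  with assms show ?thesis
    by (auto simp: Run_in_states start_in_points split: if_splits) (auto simp: states_def)
next
  case (Run l)
  then have l: "l \<in> points p" using assms by (simp add: Run_in_states)
  then have t: "targets (node l) \<subseteq> points p" by (rule targets_points)
  show ?thesis
  proof (cases "node l")
    case (Test a l1 l2)
    with l t Run assms show ?thesis
      by (cases a) (auto simp: Run_in_states sweep_state_in_states split: prod.splits)
  qed (use Run assms t in \<open>auto simp: Run_in_states\<close>)
next
  case (Forth s b l1 l2)
  with assms show ?thesis
    by (cases y) (auto simp: sweep_state_in_states)
next
  case (Back s b l1 l2)
  then obtain l where l: "l \<in> points p" "node l = Test (Sweep s) l1 l2"
    using assms by (auto simp: sweep_state_in_states)
  then have "{l1, l2} \<subseteq> points p" using targets_points by fastforce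
  with Back l assms show ?thesis
    by (cases y) (auto simp: sweep_state_in_states Run_in_states)
qed (use assms in \<open>auto simp: states_def split: if_splits\<close>)

section \<open>Numbered states and symbols, and single steps of the machine\<close>

definition code :: "'r com \<Rightarrow> 'r mstate \<Rightarrow> nat" where
  "code p = to_nat_on (states p)"

lemma code_bij: "bij_betw (code p) (states p) {..<card (states p)}"
  unfolding code_def by (rule to_nat_on_finite[OF finite_states])

lemma code_eq: "q \<in> states p \<Longrightarrow> q' \<in> states p \<Longrightarrow> code p q = code p q' \<longleftrightarrow> q = q'"
  using code_bij[of p] by (auto simp: bij_betw_def inj_on_eq_iff)

lemma code_less: "q \<in> states p \<Longrightarrow> code p q < card (states p)"
  using code_bij[of p] by (auto simp: bij_betw_def)

fun symbol_code :: "'r::finite symbol \<Rightarrow> nat" where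
  "symbol_code None = 0"
| "symbol_code (Some c) = Suc (to_nat_on UNIV c)"

lemma symbol_code_eq: "symbol_code y = symbol_code y' \<longleftrightarrow> y = y'"
  for y :: "'r::finite symbol"
proof -
  have "inj_on (to_nat_on (UNIV :: ('r \<Rightarrow> bool) set)) UNIV"
    by (rule bij_betw_imp_inj_on[OF to_nat_on_finite]) simp
  then show ?thesis by (cases y; cases y') (auto simp: inj_on_eq_iff)
qed

lemma symbol_code_less: "symbol_code y < Suc (card (UNIV :: ('r \<Rightarrow> bool) set))"
  for y :: "'r::finite symbol"
  using bij_betwE[OF to_nat_on_finite[of "UNIV :: ('r \<Rightarrow> bool) set"]] by (cases y) auto

definition machine :: "'r::finite com \<Rightarrow> ntm" where
  "machine p = \<lparr>num_tapes = 1, num_symbols = Suc (card (UNIV :: ('r \<Rightarrow> bool) set)),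
     num_states = card (states p), start = code p Init, accept = code p (Run []),
     delta = \<lambda>n x ys. {(code p q', d, [(symbol_code y', e)], ob) | q y q' d y' e ob.
       q \<in> states p \<and> n = code p q \<and> ys = [symbol_code y] \<and> (q', d, y', e, ob) \<in> act p q x y}\<rparr>"

lemma act_dir:
  "(q', d, y', e, ob) \<in> act p q x y \<Longrightarrow> (x = Lend \<longrightarrow> d \<noteq> Left) \<and> (x = Rend \<longrightarrow> d \<noteq> Right)"
  by (cases q)
    (auto simp: clamp_def split: if_splits instr.splits atom.splits prod.splits option.splits)

lemma Init_in_states: "Init \<in> states p" "Carry \<in> states p" "Return \<in> states p" "Run [] \<in> states p"
  by (auto simp: states_def points_def)

lemma delta_machine:
  assumes "(n, d, ws, ob) \<in> delta (machine p) m x ys"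
  obtains q y q' y' e where "q \<in> states p" "m = code p q" "n = code p q'" "ys = [symbol_code y]"
    "ws = [(symbol_code y', e)]" "(q', d, y', e, ob) \<in> act p q x y"
  using assms by (auto simp: machine_def)

lemma wf_machine: "wf_ntm (machine p)"
proof -
  have "m \<noteq> accept (machine p) \<and> n < num_states (machine p) \<and> length ws = num_tapes (machine p) \<and>
      (\<forall>(y, e) \<in> set ws. y < num_symbols (machine p)) \<and>
      (x = Lend \<longrightarrow> d \<noteq> Left) \<and> (x = Rend \<longrightarrow> d \<noteq> Right)"
    if "(n, d, ws, ob) \<in> delta (machine p) m x ys" for n d ws ob m x ys
    using that
  proof (rule delta_machine)
    fix q y q' y' e
    assume *: "q \<in> states p" "m = code p q" "n = code p q'" "ys = [symbol_code y]"
      "ws = [(symbol_code y', e)]" "(q', d, y', e, ob) \<in> act p q x y"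
    have "q \<noteq> Run []" using *(6) by auto
    then have "m \<noteq> accept (machine p)"
      using * Init_in_states(4)[of p] by (simp add: machine_def code_eq)
    moreover have "n < num_states (machine p)"
      using * act_states[OF *(1,6)] by (simp add: machine_def code_less)
    ultimately show ?thesis
      using * act_dir[OF *(6)] by (simp add: machine_def symbol_code_less)
  qed
  moreover have "0 < num_symbols (machine p)" "start (machine p) < num_states (machine p)"
    "accept (machine p) < num_states (machine p)"
    by (auto simp: machine_def code_less Init_in_states)
  ultimately show ?thesis unfolding wf_ntm_def by blast
qed

definition cfg :: "'r::finite com \<Rightarrow> 'r mstate \<Rightarrow> (int \<Rightarrow> 'r symbol) \<Rightarrow> int \<Rightarrow> nat \<Rightarrow> bool list \<Rightarrow> config" where
  "cfg p q f pos h o' =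
     \<lparr>state = code p q, inpos = h, work = [(symbol_code \<circ> f, pos)], written = o'\<rparr>"

lemma init_cfg: "init_config (machine p) = cfg p Init (\<lambda>_. None) 0 0 []"
  by (simp add: init_config_def machine_def cfg_def comp_def)

lemma step_cfg:
  assumes "q \<in> states p"
  shows "step (machine p) w (cfg p q f pos h o') c' \<longleftrightarrow>
    (\<exists>q' d y e ob. (q', d, y, e, ob) \<in> act p q (input_cell w h) (f pos) \<and>
       c' = cfg p q' (f(pos := y)) (pos + offset e) (move_input d h) (o' @ option_list ob))"
proof -
  have u: "(symbol_code \<circ> f)(pos := symbol_code y) = symbol_code \<circ> f(pos := y)" for y
    by auto
  have o: "(case ob of None \<Rightarrow> [] | Some b \<Rightarrow> [b]) = option_list ob" for ob :: "bool option"
    by (cases ob) auto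
  show ?thesis
  proof
    assume "step (machine p) w (cfg p q f pos h o') c'"
    then obtain n d ws ob where
      n: "(n, d, ws, ob) \<in> delta (machine p) (code p q) (input_cell w h) [symbol_code (f pos)]" and
      c': "c' = \<lparr>state = n, inpos = move_input d h,
        work = map2 update_tape ws [(symbol_code \<circ> f, pos)], written = o' @ option_list ob\<rparr>"
      by (auto simp: step_def cfg_def o)
    from n show "\<exists>q' d y e ob. (q', d, y, e, ob) \<in> act p q (input_cell w h) (f pos) \<and>
       c' = cfg p q' (f(pos := y)) (pos + offset e) (move_input d h) (o' @ option_list ob)"
    proof (rule delta_machine)
      fix q'' y q' y' e
      assume *: "q'' \<in> states p" "code p q = code p q''" "n = code p q'"
        "[symbol_code (f pos)] = [symbol_code y]" "ws = [(symbol_code y', e)]"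
        "(q', d, y', e, ob) \<in> act p q'' (input_cell w h) y"
      then have "q'' = q" "y = f pos" using assms by (simp_all add: code_eq symbol_code_eq)
      with * show ?thesis
        by (intro exI[of _ q'] exI[of _ d] exI[of _ y'] exI[of _ e] exI[of _ ob])
          (simp add: c' cfg_def u del: fun_upd_apply)
    qed
  next
    assume "\<exists>q' d y e ob. (q', d, y, e, ob) \<in> act p q (input_cell w h) (f pos) \<and>
       c' = cfg p q' (f(pos := y)) (pos + offset e) (move_input d h) (o' @ option_list ob)"
    then obtain q' d y e ob where *: "(q', d, y, e, ob) \<in> act p q (input_cell w h) (f pos)"
      "c' = cfg p q' (f(pos := y)) (pos + offset e) (move_input d h) (o' @ option_list ob)" by blast
    then have "(code p q', d, [(symbol_code y, e)], ob) \<in>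
        delta (machine p) (code p q) (input_cell w h) [symbol_code (f pos)]"
      using assms by (auto simp: machine_def)
    then show "step (machine p) w (cfg p q f pos h o') c'"
      unfolding step_def
      by (intro exI[of _ "code p q'"] exI[of _ d] exI[of _ "[(symbol_code y, e)]"] exI[of _ ob])
        (simp add: *(2) cfg_def o u del: fun_upd_apply)
  qed
qed

lemma state_accept:
  "q \<in> states p \<Longrightarrow> state (cfg p q f pos h o') = accept (machine p) \<longleftrightarrow> q = Run []"
  using code_eq Init_in_states(4)[of p] by (auto simp: cfg_def machine_def)

lemma paths_det:
  assumes "q \<in> states p" "act p q (input_cell w h) (f pos) = {(q', d, y, e, ob)}"
    and "paths (machine p) w out
      (cfg p q' (f(pos := y)) (pos + offset e) (move_input d h) (o' @ option_list ob)) m"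
  shows "paths (machine p) w out (cfg p q f pos h o') m"
proof (rule paths_step[OF _ _ assms(3)])
  show "state (cfg p q f pos h o') \<noteq> accept (machine p)"
    using assms by (auto simp: state_accept)
qed (simp add: step_cfg[OF assms(1)] assms(2))

text \<open>In this form the simplifier turns an explicit set of actions into a disjunction over its
  elements, as the fork rule requires.\<close>

lemma step_cfg_Bex:
  assumes "q \<in> states p"
  shows "step (machine p) w (cfg p q f pos h o') c' \<longleftrightarrow>
    (\<exists>(q', d, y, e, ob) \<in> act p q (input_cell w h) (f pos).
       c' = cfg p q' (f(pos := y)) (pos + offset e) (move_input d h) (o' @ option_list ob))"
  unfolding step_cfg[OF assms] Bex_def split_paired_Ex by simp

section \<open>Simulation of program executions on the tape\<close>

definition tape :: "'a list \<Rightarrow> int \<Rightarrow> 'a option" where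
  "tape cs = (\<lambda>i. if 0 \<le> i \<and> i < int (length cs) then Some (cs ! nat i) else None)"

lemma tape_neg [simp]: "tape cs (- 1) = None"
  by (simp add: tape_def)

lemma tape_end [simp]: "tape cs (int (length cs)) = None"
  by (simp add: tape_def)

lemma tape_mid [simp]: "tape (xs @ c # ys) (int (length xs)) = Some c"
  by (simp add: tape_def)

lemma tape_upd: "(tape (xs @ c # ys))(int (length xs) := Some c') = tape (xs @ c' # ys)"
  by (auto simp: tape_def fun_eq_iff nth_append nth_Cons')

lemma tape_snoc: "(tape xs)(int (length xs) := Some c) = tape (xs @ [c])"
  by (auto simp: tape_def fun_eq_iff nth_append nth_Cons')

lemma tape_Nil: "tape [] = (\<lambda>_. None)"
  by (auto simp: tape_def)

text \<open>In the induction \<open>ds\<close> are the columns already rewritten and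
  \<open>cs\<close> those still ahead. The blank behind the last column makes the head turn
  round.\<close>

lemma paths_forth:
  assumes "Forth s b l1 l2 \<in> states p" "fwd s b cs = (b', cs')"
    and "paths (machine p) w out
      (cfg p (Back s b' l1 l2) (tape (ds @ cs')) (int (length (ds @ cs')) - 1) h o') m"
  shows "paths (machine p) w out (cfg p (Forth s b l1 l2) (tape (ds @ cs)) (int (length ds)) h o') m"
  using assms
proof (induction cs arbitrary: ds b cs')
  case Nil
  then show ?case
    by - (rule paths_det[where q' = "Back s b l1 l2" and d = Stay and y = None and e = Left and ob = None],
      auto simp: fun_upd_idem)
next
  case (Cons c cs)
  obtain b1 c1 where 1: "fwd_step s b c = (b1, c1)" by force
  obtain cs1 where 2: "fwd s b1 cs = (b', cs1)" "cs' = c1 # cs1"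
    using Cons.prems(2) 1 by (auto split: prod.splits)
  have "Forth s b1 l1 l2 \<in> states p"
    using Cons.prems(1) by (simp add: sweep_state_in_states)
  then have "paths (machine p) w out
      (cfg p (Forth s b1 l1 l2) (tape ((ds @ [c1]) @ cs)) (int (length (ds @ [c1]))) h o') m"
    using Cons.IH[OF _ 2(1), of "ds @ [c1]"] Cons.prems(3) 2(2) by simp
  then show ?case
    using Cons.prems(1)
    by - (rule paths_det[where q' = "Forth s b1 l1 l2" and d = Stay and y = "Some c1" and e = Right
          and ob = None], simp_all add: 1 tape_upd add.commute)
qed

lemma bwd_snoc:
  "bwd s b (cs @ [c]) =
     (case bwd_step s b c of (b1, ob) \<Rightarrow> case bwd s b1 cs of (b2, e) \<Rightarrow> (b2, option_list ob @ e))"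
  by (induction cs) (auto split: prod.splits)

text \<open>The head moves left, hence the induction on \<open>cs\<close> from its right end; the
  blank at cell -1 ends the pass.\<close>

lemma paths_back:
  assumes "Back s b l1 l2 \<in> states p" "bwd s b cs = (b', e)"
    and "paths (machine p) w out
      (cfg p (Run (if b' then l1 else l2)) (tape (cs @ ds)) 0 h (o' @ e)) m"
  shows "paths (machine p) w out
      (cfg p (Back s b l1 l2) (tape (cs @ ds)) (int (length cs) - 1) h o') m"
  using assms
proof (induction cs arbitrary: ds b e o' rule: rev_induct)
  case Nil
  then show ?case
    by - (rule paths_det[where q' = "Run (if b then l1 else l2)" and d = Stay and y = None and e = Right
          and ob = None], auto simp: fun_upd_idem)
next
  case (snoc c cs)
  obtain b1 ob where 1: "bwd_step s b c = (b1, ob)" by force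
  obtain e1 where 2: "bwd s b1 cs = (b', e1)" "e = option_list ob @ e1"
    using snoc.prems(2) 1 by (auto simp: bwd_snoc split: prod.splits)
  have "Back s b1 l1 l2 \<in> states p"
    using snoc.prems(1) by (simp add: sweep_state_in_states)
  then have "paths (machine p) w out
      (cfg p (Back s b1 l1 l2) (tape (cs @ c # ds)) (int (length cs) - 1) h (o' @ option_list ob)) m"
    using snoc.IH[OF _ 2(1), of "c # ds" "o' @ option_list ob"] snoc.prems(3) 2(2) by simp
  then show ?case
    using snoc.prems(1)
    by - (rule paths_det[where q' = "Back s b1 l1 l2" and d = Stay and y = "Some c" and e = Left
          and ob = ob], simp_all add: 1 fun_upd_idem)
qed

lemma node_Halt: "node l = Halt \<Longrightarrow> l = []"
  by (cases l rule: node.cases) auto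

lemma node_Fork: "node l = Fork l1 l2 \<Longrightarrow> l1 \<noteq> l2"
  by (cases l rule: node.cases) (auto dest: arg_cong[of _ _ length])

lemma exec_bounded:
  assumes "exec w L a (\<rho>, h, o') = (b, \<rho>', h', o'')" "\<And>r. \<rho> r < 2 ^ L"
  shows "\<rho>' r < 2 ^ L"
  using assms by (cases a) (auto split: prod.splits dest: sweep_sem_bounded[rotated])

text \<open>Between two instructions the work head stands on column 0 and the tape holds exactly the
  \<open>L\<close> columns of the valuation, so each instruction is simulated in isolation. Machine
  and program branch at the same places, which makes the two counts equal.\<close>

lemma paths_runs:
  assumes "runs w L out l \<sigma> m" "\<sigma> = (\<rho>, h, o')" "l \<in> points p" "\<And>r. \<rho> r < 2 ^ L"
  shows "paths (machine p) w out (cfg p (Run l) (tape (columns L \<rho>)) 0 h o') m"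
  using assms
proof (induction arbitrary: \<rho> h o' rule: runs.induct)
  case (runs_halt l \<rho> h \<rho>' h' o')
  then show ?case
    by - (rule paths_accept, auto simp: state_accept Run_in_states cfg_def machine_def dest: node_Halt)
next
  case (runs_abort l \<sigma>)
  then have "l \<noteq> []" by auto
  then show ?case
    using runs_abort by - (rule paths_stuck, auto simp: state_accept Run_in_states step_cfg)
next
  case (runs_goto l l' \<sigma> m)
  then have "l' \<in> points p" using targets_points[OF runs_goto.prems(2)] by simp
  then have "paths (machine p) w out (cfg p (Run l') (tape (columns L \<rho>)) 0 h o') m"
    using runs_goto by blast
  then show ?case
    using runs_goto.hyps(1) runs_goto.prems
    by - (rule paths_det[where q' = "Run l'" and d = Stay and e = Stay and y = "tape (columns L \<rho>) 0" and ob = None],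
      auto simp: Run_in_states)
next
  case (runs_fork l l1 l2 \<sigma> m1 m2)
  have p: "l1 \<in> points p" "l2 \<in> points p"
    using targets_points[OF runs_fork.prems(2)] runs_fork.hyps(1) by auto
  let ?c = "\<lambda>l. cfg p (Run l) (tape (columns L \<rho>)) 0 h o'"
  \<comment> \<open>The two branches of \<open>Star\<close> are control stacks of different lengths,
    so the successors already differ in their state.\<close>
  have "state (?c l1) \<noteq> state (?c l2)"
    using p node_Fork[OF runs_fork.hyps(1)] by (simp add: cfg_def code_eq Run_in_states)
  moreover have "step (machine p) w (?c l) z \<longleftrightarrow> z = ?c l1 \<or> z = ?c l2" for z
    using runs_fork.prems runs_fork.hyps(1) by (simp add: step_cfg_Bex Run_in_states)
  moreover have "l \<noteq> []" using runs_fork.hyps(1) by auto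
  ultimately show ?case
    using runs_fork.IH(1)[OF runs_fork.prems(1) p(1) runs_fork.prems(3)] 
      runs_fork.IH(2)[OF runs_fork.prems(1) p(2) runs_fork.prems(3)] runs_fork.prems(2)
    by - (rule paths_fork[of "?c l" _ _ "?c l1" "?c l2"], auto simp: state_accept Run_in_states)
next
  case (runs_test l a l1 l2 \<sigma> b \<sigma>' m)
  have p: "l1 \<in> points p" "l2 \<in> points p"
    using targets_points[OF runs_test.prems(2)] runs_test.hyps(1) by auto
  obtain \<rho>' h' o'' where s: "\<sigma>' = (\<rho>', h', o'')" by (cases \<sigma>')
  have ex: "exec w L a (\<rho>, h, o') = (b, \<rho>', h', o'')" using runs_test.hyps(2) runs_test.prems s by simp
  have IH: "paths (machine p) w out
      (cfg p (Run (if b then l1 else l2)) (tape (columns L \<rho>')) 0 h' o'') m"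
    using runs_test.IH[OF s] p exec_bounded[OF ex runs_test.prems(3)] by simp
  show ?case
  proof (cases a)
    case (Sweep t)
    obtain e where e: "sweep_sem L t \<rho> = (b, \<rho>', e)" "h' = h" "o'' = o' @ e"
      using ex Sweep by (auto split: prod.splits)
    obtain b' where b': "fwd t False (columns L \<rho>) = (b', columns L \<rho>')"
      "bwd t b' (columns L \<rho>') = (b, e)"
      using sweep_columns[OF runs_test.prems(3) e(1)] by blast
    have st: "Forth t False l1 l2 \<in> states p" "Back t b' l1 l2 \<in> states p"
      using runs_test.prems(2) runs_test.hyps(1) Sweep by (auto simp: sweep_state_in_states)
    have "paths (machine p) w out
        (cfg p (Back t b' l1 l2) (tape ([] @ columns L \<rho>')) (int (length ([] @ columns L \<rho>')) - 1) h o') m"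
      using paths_back[OF st(2) b'(2), of w out "[]" h o' m] IH e by simp
    from paths_forth[OF st(1) b'(1) this] show ?thesis
      using runs_test.prems(2) runs_test.hyps(1) Sweep
      by - (rule paths_det[where q' = "Forth t False l1 l2" and d = Stay and e = Stay and y = "tape (columns L \<rho>) 0" and ob = None],
        auto simp: Run_in_states)
  next
    case (Look g)
    obtain d b1 ob where g: "g (input_cell w h) = (d, b1, ob)" by (cases "g (input_cell w h)")
    show ?thesis
      using runs_test.prems(2) runs_test.hyps(1) Look g IH ex
      by - (rule paths_det[where q' = "Run (if b then l1 else l2)" and d = "clamp (input_cell w h) d"
            and e = Stay and y = "tape (columns L \<rho>) 0" and ob = ob], auto simp: Run_in_states)
  qed
qed

section \<open>Counting the input\<close>

fun bin_inc :: "bool list \<Rightarrow> bool list" where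
  "bin_inc [] = [True]"
| "bin_inc (False # bs) = True # bs"
| "bin_inc (True # bs) = False # bin_inc bs"

fun bin_val :: "bool list \<Rightarrow> nat" where
  "bin_val [] = 0"
| "bin_val (b # bs) = of_bool b + 2 * bin_val bs"

definition counter :: "nat \<Rightarrow> bool list" where
  "counter i = (bin_inc ^^ i) []"

text \<open>The number of binary digits of \<open>n + 1\<close>, the head position of the right end
  marker on inputs of length \<open>n\<close>. Hence \<open>2 ^ width n\<close> exceeds every head
  position and is at most \<open>2 * (n + 1)\<close>.\<close>

definition width :: "nat \<Rightarrow> nat" where
  "width n = length (counter (Suc n))"

definition tracks :: "bool list \<Rightarrow> ('r \<Rightarrow> bool) list" where
  "tracks = map (\<lambda>b _. b)"

lemma counter_0: "counter 0 = []"
  and counter_Suc: "counter (Suc i) = bin_inc (counter i)"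
  by (simp_all add: counter_def)

lemma bin_val_inc: "bin_val (bin_inc bs) = Suc (bin_val bs)"
  by (induction bs rule: bin_inc.induct) auto

lemma bin_val_counter: "bin_val (counter i) = i"
  by (induction i) (auto simp: counter_0 counter_Suc bin_val_inc)

lemma bin_val_less: "bin_val bs < 2 ^ length bs"
  by (induction bs) auto

lemma length_bin_inc: "length bs \<le> length (bin_inc bs)"
  by (induction bs rule: bin_inc.induct) auto

lemma length_counter_mono: "i \<le> j \<Longrightarrow> length (counter i) \<le> length (counter j)"
  by (induction rule: dec_induct) (auto simp: counter_Suc intro: order_trans length_bin_inc)

lemma last_bin_inc: "bs = [] \<or> last bs \<Longrightarrow> bin_inc bs \<noteq> [] \<and> last (bin_inc bs)"
  by (induction bs rule: bin_inc.induct) (auto split: if_splits)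

lemma bin_val_ge: "bs \<noteq> [] \<Longrightarrow> last bs \<Longrightarrow> 2 ^ length bs \<le> 2 * bin_val bs"
  by (induction bs) (auto split: if_splits)

text \<open>Counting never creates a leading zero; this keeps the number of columns
  logarithmic.\<close>

lemma last_counter: "counter i = [] \<or> last (counter i)"
proof (induction i)
  case (Suc i)
  from last_bin_inc[OF this] show ?case by (simp add: counter_Suc)
qed (simp add: counter_0)

lemma two_power_width: "2 ^ width n \<le> 2 * Suc n"
proof -
  have "counter (Suc n) \<noteq> [] \<and> last (counter (Suc n))"
    unfolding counter_Suc using last_counter by (rule last_bin_inc)
  then show ?thesis using bin_val_ge bin_val_counter unfolding width_def by metis
qed

lemma less_two_power_width: "Suc n < 2 ^ width n"
  using bin_val_less[of "counter (Suc n)"] by (simp add: width_def bin_val_counter)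

lemma tracks_columns: "tracks bs = columns (length bs) (\<lambda>_. bin_val bs)"
  by (induction bs) (auto simp: tracks_def)

lemma paths_return:
  assumes "paths (machine p) w out (cfg p Init (tape (xs @ ys)) 0 h o') m"
  shows "paths (machine p) w out (cfg p Return (tape (xs @ ys)) (int (length xs) - 1) h o') m"
  using assms
proof (induction xs arbitrary: ys rule: rev_induct)
  case Nil
  then show ?case
    by - (rule paths_det[where q' = Init and d = Stay and y = None and e = Right and ob = None],
      auto simp: fun_upd_idem Init_in_states)
next
  case (snoc c xs)
  then have "paths (machine p) w out (cfg p Return (tape (xs @ c # ys)) (int (length xs) - 1) h o') m"
    by simp
  then show ?case
    by - (rule paths_det[where q' = Return and d = Stay and y = "Some c" and e = Left and ob = None],
      simp_all add: fun_upd_idem Init_in_states)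
qed

text \<open>In the induction \<open>ds\<close> collects low-order bits that are already flipped. A
  new column appears only if the carry runs off the end of \<open>bs\<close>.\<close>

lemma paths_carry:
  fixes p :: "'r::finite com"
  assumes "paths (machine p) w out (cfg p Init (tape (tracks (ds @ bin_inc bs))) 0 h o') m"
  shows "paths (machine p) w out (cfg p Carry (tape (tracks (ds @ bs))) (int (length ds)) h o') m"
  using assms
proof (induction bs arbitrary: ds rule: bin_inc.induct)
  case 1
  from paths_return[of p w out "tracks ds" "tracks [True]"] 1
  have "paths (machine p) w out (cfg p Return (tape (tracks ds @ tracks [True])) (int (length ds) - 1) h o') m"
    by (simp add: tracks_def)
  then show ?case
    using tape_snoc[of "tracks ds :: ('r \<Rightarrow> bool) list" "\<lambda>_. True"] tape_end[of "tracks ds :: ('r \<Rightarrow> bool) list"]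
    by - (rule paths_det[where q' = Return and d = Stay and y = "Some (\<lambda>_. True)" and e = Left and ob = None],
      simp_all add: Init_in_states tracks_def)
next
  case (2 bs)
  from paths_return[of p w out "tracks ds" "tracks (True # bs)"] 2
  have "paths (machine p) w out (cfg p Return (tape (tracks ds @ tracks (True # bs))) (int (length ds) - 1) h o') m"
    by (simp add: tracks_def)
  moreover have "(\<lambda>_ :: 'r. False) \<noteq> (\<lambda>_. True)" by (metis)
  ultimately show ?case
    using tape_upd[of "tracks ds :: ('r \<Rightarrow> bool) list" "\<lambda>_. False" "tracks bs" "\<lambda>_. True"]
      tape_mid[of "tracks ds :: ('r \<Rightarrow> bool) list" "\<lambda>_. False" "tracks bs"]
    by - (rule paths_det[where q' = Return and d = Stay and y = "Some (\<lambda>_. True)" and e = Left and ob = None],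
      simp_all add: Init_in_states tracks_def)
next
  case (3 bs)
  from 3(1)[of "ds @ [False]"] 3(2)
  have "paths (machine p) w out (cfg p Carry (tape (tracks (ds @ False # bs))) (int (length (ds @ [False]))) h o') m"
    by simp
  then show ?case
    using tape_upd[of "tracks ds :: ('r \<Rightarrow> bool) list" "\<lambda>_. True" "tracks bs" "\<lambda>_. False"]
      tape_mid[of "tracks ds :: ('r \<Rightarrow> bool) list" "\<lambda>_. True" "tracks bs"]
    by - (rule paths_det[where q' = Carry and d = Stay and y = "Some (\<lambda>_. False)" and e = Right and ob = None],
      simp_all add: Init_in_states tracks_def add.commute)
qed

text \<open>The induction starts at the right end marker and goes back, since a count of accepting
  paths is derived from later configurations to earlier ones.\<close>

lemma paths_count_input:
  assumes "i \<le> Suc (length w)"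
    and "paths (machine p) w out
      (cfg p Init (tape (tracks (counter (Suc (length w))))) 0 (Suc (length w)) []) m"
  shows "paths (machine p) w out (cfg p Init (tape (tracks (counter i))) 0 i []) m"
  using assms(1)
proof (induction rule: inc_induct)
  case base
  show ?case by (fact assms(2))
next
  case (step i)
  from paths_carry[of p w out "[]" "counter i" "Suc i" "[]" m] step.IH
  have "paths (machine p) w out (cfg p Carry (tape (tracks (counter i))) 0 (Suc i) []) m"
    by (simp add: counter_Suc)
  then show ?case
    using step.hyps
    by - (rule paths_det[where q' = Carry and d = Right and e = Stay and y = "tape (tracks (counter i)) 0" and ob = None],
      auto simp: Init_in_states input_cell_def)
qed

text \<open>Counting the input leaves its result in every register and the head on the right end
  marker; this fixes the initial valuation of a program.\<close>

lemma paths_init: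
  assumes "runs w (width (length w)) out [p] (\<lambda>_. Suc (length w), Suc (length w), []) m"
  shows "paths (machine p) w out (init_config (machine p)) m"
proof -
  let ?n = "Suc (length w)"
  have "paths (machine p) w out
      (cfg p (Run [p]) (tape (columns (width (length w)) (\<lambda>_. ?n))) 0 ?n []) m"
    using paths_runs[OF assms refl start_in_points] less_two_power_width by blast
  then have "paths (machine p) w out (cfg p (Run [p]) (tape (tracks (counter ?n))) 0 ?n []) m"
    by (simp add: tracks_columns bin_val_counter width_def)
  then have "paths (machine p) w out (cfg p Init (tape (tracks (counter ?n))) 0 ?n []) m"
    by - (rule paths_det[where q' = "Run [p]" and d = Stay and e = Stay and y = "tape (tracks (counter ?n)) 0" and ob = None],
      auto simp: Init_in_states input_cell_def)
  from paths_count_input[OF _ this, of 0] show ?thesis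
    by (simp add: init_cfg counter_0 tracks_def tape_Nil)
qed

section \<open>Space\<close>

text \<open>The space bound is demanded of all computations on all inputs, also where no derivation
  of \<open>runs\<close> is available, such as on words that encode no instance. Hence this
  invariant of arbitrary reachable configurations, which during the execution of the program records
  only the shape of the tape and not the register contents.\<close>

fun tidy :: "nat \<Rightarrow> 'r mstate \<Rightarrow> (int \<Rightarrow> 'r symbol) \<Rightarrow> int \<Rightarrow> nat \<Rightarrow> bool" where
  "tidy n Init f pos h \<longleftrightarrow> h \<le> Suc n \<and> f = tape (tracks (counter h)) \<and> pos = 0"
| "tidy n Carry f pos h \<longleftrightarrow> h \<le> Suc n \<and>
     (\<exists>ds bs. f = tape (tracks (ds @ bs)) \<and> pos = int (length ds) \<and> ds @ bin_inc bs = counter h)"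
| "tidy n Return f pos h \<longleftrightarrow>
     h \<le> Suc n \<and> f = tape (tracks (counter h)) \<and> - 1 \<le> pos \<and> pos < int (length (counter h))"
| "tidy n (Run l) f pos h \<longleftrightarrow> (\<exists>cs. f = tape cs \<and> length cs = width n) \<and> pos = 0"
| "tidy n (Forth s b l1 l2) f pos h \<longleftrightarrow>
     (\<exists>cs. f = tape cs \<and> length cs = width n) \<and> 0 \<le> pos \<and> pos \<le> int (width n)"
| "tidy n (Back s b l1 l2) f pos h \<longleftrightarrow>
     (\<exists>cs. f = tape cs \<and> length cs = width n) \<and> - 1 \<le> pos \<and> pos < int (width n)"

lemma tidy_pos:
  assumes "tidy n q f pos h"
  shows "- 1 \<le> pos \<and> pos \<le> int (width n)"
proof -
  have *: "length (counter h) \<le> width n" if "h \<le> Suc n"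
    using length_counter_mono[OF that] by (simp add: width_def)
  show ?thesis
  proof (cases q)
    case Carry
    then obtain ds bs where "h \<le> Suc n" "pos = int (length ds)" "ds @ bin_inc bs = counter h"
      using assms by auto
    moreover from this(3) have "length ds \<le> length (counter h)" by (metis length_append le_add1)
    ultimately show ?thesis using * by fastforce
  qed (use assms * in auto)
qed

lemma tape_eq_Some: "tape cs i = Some c \<longleftrightarrow> 0 \<le> i \<and> i < int (length cs) \<and> c = cs ! nat i"
  by (auto simp: tape_def)

lemma tape_eq_None: "tape cs i = None \<longleftrightarrow> i < 0 \<or> int (length cs) \<le> i"
  by (auto simp: tape_def)

lemma tape_upd_nth:
  "0 \<le> i \<Longrightarrow> i < int (length cs) \<Longrightarrow> (tape cs)(i := Some c) = tape (cs[nat i := c])"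
  by (auto simp: tape_def fun_eq_iff nth_list_update)

lemma tidy_carry:
  fixes f :: "int \<Rightarrow> 'r symbol"
  assumes "tidy n Carry f pos h"
  shows "if f pos = Some (\<lambda>_. True) then tidy n Carry (f(pos := Some (\<lambda>_. False))) (pos + 1) h
    else tidy n Return (f(pos := Some (\<lambda>_. True))) (pos - 1) h"
proof -
  from assms obtain ds bs where h: "h \<le> Suc n" and f: "f = tape (tracks (ds @ bs))"
    and pos: "pos = int (length (tracks ds :: ('r \<Rightarrow> bool) list))"
    and c: "ds @ bin_inc bs = counter h"
    by (auto simp: tracks_def)
  show ?thesis
  proof (cases bs rule: bin_inc.cases)
    case 1
    have "f(pos := Some (\<lambda>_. True)) = tape (tracks (counter h))" "f pos = None"
      using f pos 1 by (simp_all add: tape_snoc flip: c) (simp add: tracks_def)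
    then show ?thesis using h c 1 pos by (simp add: tracks_def flip: c)
  next
    case (2 bs')
    have f': "f = tape (tracks ds @ (\<lambda>_. False) # tracks bs')" using f 2 by (simp add: tracks_def)
    have "f pos = Some (\<lambda>_. False)"
      unfolding f' pos by simp
    moreover have "f(pos := Some (\<lambda>_. True)) = tape (tracks (counter h))"
      unfolding f' pos tape_upd using 2 by (simp add: tracks_def flip: c)
    moreover have "(\<lambda>_ :: 'r. False) \<noteq> (\<lambda>_. True)" by metis
    ultimately show ?thesis using h c 2 pos by (simp add: tracks_def flip: c)
  next
    case (3 bs')
    have f': "f = tape (tracks ds @ (\<lambda>_. True) # tracks bs')" using f 3 by (simp add: tracks_def)
    have "f pos = Some (\<lambda>_. True)"
      unfolding f' pos by simp
    moreover have "f(pos := Some (\<lambda>_. False)) = tape (tracks ((ds @ [False]) @ bs'))"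
      unfolding f' pos tape_upd by (simp add: tracks_def)
    moreover have "pos + 1 = int (length (ds @ [False]))" "(ds @ [False]) @ bin_inc bs' = counter h"
      using pos c 3 by (simp_all add: tracks_def)
    ultimately show ?thesis using h by (simp only: tidy.simps refl if_True simp_thms) blast
  qed
qed

lemma tidy_step:
  assumes "tidy (length w) q f pos h" "(q', d, y, e, ob) \<in> act p q (input_cell w h) (f pos)"
  shows "tidy (length w) q' (f(pos := y)) (pos + offset e) (move_input d h)"
proof (cases q)
  case Init
  show ?thesis
  proof (cases "input_cell w h = Rend")
    case True
    then have "h = Suc (length w)" using assms(1) Init
      by (auto simp: input_cell_def split: if_splits)
    then show ?thesis using True assms Init
      by (auto intro!: exI[of _ "tracks (counter (Suc (length w)))"] simp: width_def tracks_def)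
  next
    case False
    then have "h \<le> length w" by (auto simp: input_cell_def split: if_splits)
    then show ?thesis using False assms Init
      by (auto simp: counter_Suc intro!: exI[of _ "[]"] exI[of _ "counter h"])
  qed
next
  case Carry
  then show ?thesis using assms tidy_carry[of "length w" f pos h] by (auto split: if_splits)
next
  case Return
  then show ?thesis using assms
    by (auto simp: tape_eq_None tracks_def split: if_splits)
next
  case (Run l)
  then show ?thesis using assms
    by (auto split: instr.splits atom.splits prod.splits)
next
  case (Forth s b l1 l2)
  then obtain cs where cs: "f = tape cs" "length cs = width (length w)" "0 \<le> pos" "pos \<le> int (length cs)"
    using assms(1) by auto
  show ?thesis
  proof (cases "f pos")
    case None
    then show ?thesis using assms(2) Forth cs by (auto simp: fun_upd_idem)
  next
    case (Some c)
    then have "pos < int (length cs)" using cs by (simp add: tape_eq_Some)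
    then have "f(pos := Some (snd (fwd_step s b c))) = tape (cs[nat pos := snd (fwd_step s b c)])"
      "pos + 1 \<le> int (length cs)" using cs by (simp_all add: tape_upd_nth)
    then show ?thesis using assms(2) Forth cs Some
      by (auto intro!: exI[of _ "cs[nat pos := snd (fwd_step s b c)]"])
  qed
next
  case (Back s b l1 l2)
  then show ?thesis using assms
    by (auto simp: fun_upd_idem tape_eq_Some tape_eq_None split: option.splits)
qed

lemma successively_invariant:
  assumes "successively R xs" "xs \<noteq> []" "P (hd xs)" "\<And>x y. R x y \<Longrightarrow> P x \<Longrightarrow> P y" "x \<in> set xs"
  shows "P x"
  using assms(1,2,3,5)
proof (induction xs)
  case (Cons a xs)
  show ?case
  proof (cases xs)
    case (Cons b ys)
    then have "P b" using Cons.prems assms(4)[of a b] by auto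
    then show ?thesis using Cons Cons.prems Cons.IH by auto
  qed (use Cons.prems in auto)
qed simp

lemma scanned_cells_machine:
  assumes "computation (machine p) w cs"
  shows "card (scanned_cells cs) \<le> width (length w) + 2"
proof -
  let ?P = "\<lambda>c. \<exists>q f pos h o'. c = cfg p q f pos h o' \<and> q \<in> states p \<and> tidy (length w) q f pos h"
  have inv: "?P c" if "c \<in> set cs" for c
  proof (rule successively_invariant[where P = ?P and R = "step (machine p) w" and xs = cs])
    show "?P (hd cs)"
    proof (intro exI conjI)
      show "hd cs = cfg p Init (\<lambda>_. None) 0 0 []"
        using assms by (simp add: computation_def init_cfg)
    qed (simp_all add: Init_in_states counter_0 tracks_def tape_Nil)
  next
    fix c c' assume *: "step (machine p) w c c'" "?P c"
    then obtain q f pos h o' where c: "c = cfg p q f pos h o'" "q \<in> states p" "tidy (length w) q f pos h"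
      by blast
    then obtain q' d y e ob where **: "(q', d, y, e, ob) \<in> act p q (input_cell w h) (f pos)"
      "c' = cfg p q' (f(pos := y)) (pos + offset e) (move_input d h) (o' @ option_list ob)"
      using *(1) step_cfg by blast
    then show "?P c'"
      using act_states[OF c(2) **(1)] tidy_step[OF c(3) **(1)] by blast
  qed (use assms that in \<open>auto simp: computation_def\<close>)
  \<comment> \<open>Besides the columns only one blank cell at either end is visited, which accounts
    for the summand 2.\<close>
  have "scanned_cells cs \<subseteq> {0} \<times> {- 1 .. int (width (length w))}"
  proof
    fix x assume "x \<in> scanned_cells cs"
    then obtain c i where x: "x = (i, snd (work c ! i))" "c \<in> set cs" "i < length (work c)"
      by (auto simp: scanned_cells_def)
    with inv[OF x(2)] show "x \<in> {0} \<times> {- 1 .. int (width (length w))}"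
      by (auto simp: cfg_def dest: tidy_pos)
  qed
  then have "card (scanned_cells cs) \<le> card ({0 :: nat} \<times> {- 1 .. int (width (length w))})"
    by (intro card_mono) auto
  also have "\<dots> = width (length w) + 2" by (simp add: card_cartesian_product)
  finally show ?thesis .
qed

lemma logspace_machine: "logspace (machine p)"
proof -
  \<comment> \<open>The constant: \<open>2 ^ width n \<le> 2 * (n + 1)\<close> and
    \<open>n + 1 \<le> n * n\<close> give \<open>width n * ln 2 \<le> ln 2 + 2 * ln n\<close>;
    adding \<open>2 * ln 2\<close> and using \<open>ln 2 \<le> ln n\<close> yields
    \<open>5 * ln n\<close>.\<close>
  have "norm (real (width n + 2)) \<le> 5 / ln 2 * norm (ln (real n))" if "2 \<le> n" for n :: nat
  proof -
    have "real (2 ^ width n) \<le> real (2 * Suc n)"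
      using two_power_width[of n] by (simp only: of_nat_le_iff)
    then have "ln (2 ^ width n) \<le> ln (2 * real (Suc n))"
      by (subst ln_le_cancel_iff) auto
    moreover have "ln (2 * real (Suc n)) = ln 2 + ln (real (Suc n))"
      by (subst ln_mult) auto
    ultimately have 1: "real (width n) * ln 2 \<le> ln 2 + ln (real (Suc n))"
      by (simp only: ln_realpow)
    have "2 * n \<le> n * n" using that by (rule mult_le_mono1)
    then have "Suc n \<le> n\<^sup>2" using that by (simp only: power2_eq_square)
    then have "real (Suc n) \<le> real n ^ 2" by (metis of_nat_le_iff of_nat_power)
    then have "ln (real (Suc n)) \<le> ln (real n ^ 2)"
      by (subst ln_le_cancel_iff) (use that in auto)
    also have "\<dots> = 2 * ln (real n)" using that by (simp add: ln_realpow)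
    finally have 2: "ln (real (Suc n)) \<le> 2 * ln (real n)" .
    have "ln 2 \<le> ln (real n)" using that by simp
    then have "(real (width n) + 2) * ln 2 \<le> 5 * ln (real n)"
      using 1 2 by (simp add: algebra_simps)
    then show ?thesis using that by (simp add: field_simps)
  qed
  then have "(\<lambda>n. real (width n + 2)) \<in> O(\<lambda>n. ln (real n))"
    by (intro bigoI[where c = "5 / ln 2"] eventually_sequentiallyI[of 2])
  then show ?thesis
    unfolding logspace_def using scanned_cells_machine
    by (intro exI[of _ "\<lambda>n. width n + 2"] conjI) auto
qed

text \<open>The interface to the machine model: beyond this point only executions of a program have
  to be counted.\<close>

lemma computable_by_program:
  fixes p :: "'r::finite com"
  assumes "\<And>x. x \<in> P \<Longrightarrow>
    runs (enc x) (width (length (enc x))) (binary (f x)) [p]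
      (\<lambda>_. Suc (length (enc x)), Suc (length (enc x)), []) 1"
  shows "computable_in_UL_coUL P enc f"
  unfolding computable_in_UL_coUL_def
proof (intro exI[of _ "machine p"] conjI ballI)
  fix x assume "x \<in> P"
  note * = paths_unique[OF paths_init[OF assms[OF this]] wf_machine]
  show "\<not> (\<exists>g. infinite_computation (machine p) (enc x) g)"
    "\<exists>!cs. accepting (machine p) (enc x) cs"
    "\<forall>cs. accepting (machine p) (enc x) cs \<longrightarrow> written (last cs) = binary (f x)"
    using * by blast+
qed (rule wf_machine logspace_machine)+

section \<open>Executing programs\<close>

declare fun_upd_apply [simp del] fun_upd_same [simp] fun_upd_other [simp]

lemma runs_Nil: "runs w L out [] \<sigma> m \<longleftrightarrow> snd (snd \<sigma>) = out \<and> m = 1"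
  by (subst runs.simps, cases \<sigma>) auto

lemma runs_Skip: "runs w L out (Skip # K) \<sigma> m \<longleftrightarrow> runs w L out K \<sigma> m"
  by (subst runs.simps, cases \<sigma>) auto

lemma runs_Fail: "runs w L out (Fail # K) \<sigma> m \<longleftrightarrow> m = 0"
  by (subst runs.simps, cases \<sigma>) auto

lemma runs_Seq: "runs w L out (Seq a b # K) \<sigma> m \<longleftrightarrow> runs w L out (a # b # K) \<sigma> m"
  by (subst runs.simps, cases \<sigma>) auto

lemma runs_Cond:
  "runs w L out (Cond t a b # K) \<sigma> m \<longleftrightarrow>
     (case exec w L t \<sigma> of (r, \<sigma>') \<Rightarrow> runs w L out ((if r then a else b) # K) \<sigma>' m)"
  by (subst runs.simps, cases \<sigma>) (auto split: prod.splits if_splits)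

lemma runs_Loop:
  "runs w L out (Loop t a # K) \<sigma> m \<longleftrightarrow>
     (case exec w L t \<sigma> of (r, \<sigma>') \<Rightarrow>
        runs w L out (if r then a # Loop t a # K else K) \<sigma>' m)"
  by (subst runs.simps, cases \<sigma>) (auto split: prod.splits)

lemma runs_Star:
  "runs w L out K \<sigma> m1 \<Longrightarrow> runs w L out (a # Star a # K) \<sigma> m2 \<Longrightarrow>
   runs w L out (Star a # K) \<sigma> (m1 + m2)"
  by (rule runs_fork) auto

fun block :: "'r com list \<Rightarrow> 'r com" where
  "block [] = Skip"
| "block (c # cs) = Seq c (block cs)"

abbreviation clear :: "'r \<Rightarrow> 'r com" where
  "clear r \<equiv> Cond (Sweep (Clear r)) Skip Skip"

abbreviation incr :: "'r \<Rightarrow> 'r com" where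
  "incr r \<equiv> Cond (Sweep (Incr r)) Skip Skip"

abbreviation plus_to :: "'r \<Rightarrow> 'r \<Rightarrow> 'r com" where
  "plus_to r r' \<equiv> Cond (Sweep (Plus r r')) Skip Skip"

abbreviation less :: "'r \<Rightarrow> 'r \<Rightarrow> 'r atom" where
  "less r r' \<equiv> Sweep (Less r r')"

abbreviation advance :: "'r com" where
  "advance \<equiv> Cond (Look (\<lambda>_. (Right, True, None))) Skip Skip"

abbreviation read_bit :: "'r atom" where
  "read_bit \<equiv> Look (\<lambda>x. (Stay, x = Bit True, None))"

abbreviation step_left :: "'r atom" where
  "step_left \<equiv> Look (\<lambda>x. if x = Lend then (Stay, False, None) else (Left, True, None))"

abbreviation step_unary :: "'r atom" where
  "step_unary \<equiv> Look (\<lambda>x. (Right, x = Bit True, None))"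

lemmas runs_simps = runs_Nil runs_Skip runs_Fail runs_Seq runs_Cond if_cancel

text \<open>\<open>runs\<close> counts executions of the entire remaining program, so the effect of
  the body is stated for an arbitrary continuation \<open>K\<close>. A nondeterministic body fits
  this form too, provided that the counts over all its guesses add up to \<open>m\<close> again; in
  this way the scan of all sources can occur in a loop body.\<close>

lemma runs_for:
  assumes "I k \<rho> h" "k \<le> n" "\<And>k \<rho> h. I k \<rho> h \<Longrightarrow> \<rho> i = k \<and> \<rho> b = n"
    and body: "\<And>k \<rho> h K. I k \<rho> h \<Longrightarrow> k < n \<Longrightarrow>
      (\<And>\<rho>' h'. I (Suc k) \<rho>' h' \<Longrightarrow> runs w L out K (\<rho>', h', o') m) \<Longrightarrow> runs w L out (c # K) (\<rho>, h, o') m"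
    and exit: "\<And>\<rho> h. I n \<rho> h \<Longrightarrow> runs w L out K (\<rho>, h, o') m"
  shows "runs w L out (Loop (less i b) c # K) (\<rho>, h, o') m"
  using assms(2,1)
proof (induction arbitrary: \<rho> h rule: inc_induct)
  case base
  then have "\<rho> i = n" "\<rho> b = n" using assms(3) by blast+
  then show ?case using exit[OF base] by (simp add: runs_Loop)
next
  case (step k)
  then have "\<rho> i = k" "\<rho> b = n" using assms(3) by blast+
  moreover have "runs w L out (c # Loop (less i b) c # K) (\<rho>, h, o') m"
    using step by (intro body) auto
  ultimately show ?case using step.hyps by (simp add: runs_Loop)
qed

lemma input_cell_not_Lend: "input_cell w h = Lend \<longleftrightarrow> h = 0"
  by (simp add: input_cell_def)

lemma input_cell_not_Rend: "input_cell w h = Rend \<longleftrightarrow> length w < h"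
  by (auto simp: input_cell_def)

lemma runs_rewind:
  assumes "runs w L out K (\<rho>, 0, o') m"
  shows "runs w L out (Loop step_left Skip # K) (\<rho>, h, o') m"
proof (induction h)
  case 0
  then show ?case using assms by (simp add: runs_Loop input_cell_not_Lend clamp_def)
next
  case (Suc h)
  then show ?case by (subst runs_Loop) (simp add: runs_Skip input_cell_not_Lend clamp_def)
qed

lemma runs_measure_position:
  assumes "\<rho> r + h < 2 ^ L" "runs w L out K (\<rho>(r := \<rho> r + h), 0, o') m"
  shows "runs w L out (Loop step_left (incr r) # K) (\<rho>, h, o') m"
  using assms
proof (induction h arbitrary: \<rho>)
  case 0
  then show ?case by (simp add: runs_Loop input_cell_not_Lend clamp_def)
next
  case (Suc h)
  then show ?case using Suc.IH[of "\<rho>(r := Suc (\<rho> r))"]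
    by (subst runs_Loop) (simp add: runs_simps input_cell_not_Lend clamp_def)
qed

lemma runs_count_unary:
  assumes "\<And>i. i < k \<Longrightarrow> input_cell w (h + i) = Bit True" "input_cell w (h + k) = Bit False"
    "\<rho> r + k < 2 ^ L" "runs w L out K (\<rho>(r := \<rho> r + k), Suc (h + k), o') m"
  shows "runs w L out (Loop step_unary (incr r) # K) (\<rho>, h, o') m"
  using assms
proof (induction k arbitrary: \<rho> h)
  case 0
  then show ?case by (simp add: runs_Loop clamp_def)
next
  case (Suc k)
  have "input_cell w h = Bit True" using Suc.prems(1)[of 0] by simp
  moreover have "runs w L out (Loop step_unary (incr r) # K) (\<rho>(r := Suc (\<rho> r)), Suc h, o') m"
    using Suc.prems(1)[of "Suc _"] Suc.prems(2-) by (intro Suc.IH) auto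
  ultimately show ?case using Suc.prems(3)
    by (subst runs_Loop) (simp add: runs_simps clamp_def)
qed

lemma runs_skip_unary:
  assumes "\<And>i. i < k \<Longrightarrow> input_cell w (h + i) = Bit True" "input_cell w (h + k) = Bit False"
    "runs w L out K (\<rho>, Suc (h + k), o') m"
  shows "runs w L out (Loop step_unary Skip # K) (\<rho>, h, o') m"
  using assms
proof (induction k arbitrary: h)
  case 0
  then show ?case by (simp add: runs_Loop clamp_def)
next
  case (Suc k)
  have "input_cell w h = Bit True" using Suc.prems(1)[of 0] by simp
  moreover have "runs w L out (Loop step_unary Skip # K) (\<rho>, Suc h, o') m"
    using Suc.prems(1)[of "Suc _"] Suc.prems(2-) by (intro Suc.IH) auto
  ultimately show ?case by (subst runs_Loop) (simp add: runs_simps clamp_def)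
qed

section \<open>The program\<close>

datatype reg =
  Zero | Size | Base | Total | Level | Mass | Count | Vertex | Found | Source | Address
| CappedSum | LengthSum | Current | Length | Pred | PredAddress | Counter

instance reg :: finite
proof
  have "(UNIV :: reg set) \<subseteq> {Zero, Size, Base, Total, Level, Mass, Count, Vertex, Found, Source,
      Address, CappedSum, LengthSum, Current, Length, Pred, PredAddress, Counter}"
  proof
    fix r :: reg
    show "r \<in> {Zero, Size, Base, Total, Level, Mass, Count, Vertex, Found, Source,
      Address, CappedSum, LengthSum, Current, Length, Pred, PredAddress, Counter}"
      by (cases r) simp_all
  qed
  then show "finite (UNIV :: reg set)" by (rule finite_subset) simp
qed

text \<open>
  \<open>Total\<close> is the guess \<open>T\<close>, \<open>Level\<close> is \<open>k\<close> and \<open>Mass\<close> is \<open>M k\<close>.  The entry \<open>(v, u)\<close> of the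
  adjacency matrix is at position \<open>Base + u + v * Size\<close> of the input, so stepping to the next
  predecessor \<open>v\<close> of \<open>u\<close> means adding \<open>Size\<close> to the address.
\<close>

definition seek :: "reg \<Rightarrow> reg com" where
  "seek r = block [Loop step_left Skip, clear Counter,
     Loop (less Counter r) (block [incr Counter, advance])]"

text \<open>\<open>Pred\<close> starts at 0 and is raised a guessed number of times, so each vertex
  is chosen by exactly one execution. Raising it to \<open>Size\<close> fails, which also bounds the
  repetitions.\<close>

definition choose_pred :: "reg com" where
  "choose_pred = Star (block [incr Pred, Cond (less Pred Size) Skip Fail, plus_to PredAddress Size])"

text \<open>The number of repetitions is the length and the choices are the vertices, so the
  executions that do not fail correspond one to one to the walks ending at the initial value of
  \<open>Current\<close>.\<close>

definition guess_walk :: "reg com" where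
  "guess_walk = Star (block [clear Pred, clear PredAddress, plus_to PredAddress Base,
     plus_to PredAddress Current, choose_pred, seek PredAddress, Cond read_bit Skip Fail,
     clear Current, plus_to Current Pred, incr Length])"

definition visit :: "reg com" where
  "visit = block [clear Current, plus_to Current Source, clear Length, guess_walk,
     plus_to LengthSum Length,
     Cond (less Length Level)
       (plus_to CappedSum Length)
       (block [plus_to CappedSum Level, seek Address,
          Cond read_bit (block [clear Found, incr Found]) Skip]),
     plus_to Address Size, incr Source]"

text \<open>Guessed lengths never exceed the depths, so one-sided tests suffice:
  \<open>CappedSum\<close> cannot exceed a correct \<open>Mass\<close>. \<open>Address\<close>
  starts at the matrix entry for the arc from vertex 0 to \<open>Vertex\<close>.\<close>

definition scan_sources :: "reg com" where
  "scan_sources = block [clear Found, clear CappedSum, clear LengthSum, clear Source,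
     clear Address, plus_to Address Base, plus_to Address Vertex,
     Loop (less Source Size) visit,
     Cond (less CappedSum Mass) Fail Skip, Cond (less LengthSum Total) Fail Skip]"

definition count_next_level :: "reg com" where
  "count_next_level = block [clear Count, clear Vertex,
     Loop (less Vertex Size)
       (block [scan_sources, Cond (less Zero Found) (incr Count) Skip, incr Vertex])]"

text \<open>All registers start with the same nonzero value, so even the constant
  \<open>Zero\<close> has to be produced. \<open>Base\<close> is the head position behind the third
  unary number, counted while the head returns to the left end.\<close>

definition parse :: "reg com" where
  "parse = block [clear Zero, Loop step_left Skip, advance, clear Size,
     Loop step_unary (incr Size), Loop step_unary Skip, Loop step_unary Skip,
     clear Base, Loop step_left (incr Base)]"

text \<open>\<open>Count\<close> is set to 1 to enter the loop, which ends when no depth exceeds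
  \<open>Level\<close>. The last two comparisons together test \<open>Mass = Total\<close>. Since
  \<open>Emit\<close> writes nothing for 0, the word \<open>[False]\<close>, its binary form, is
  written separately.\<close>

definition longest_path_program :: "reg com" where
  "longest_path_program = block [parse,
     clear Total, Star (Cond (Sweep (Incr Total)) Skip Fail),
     clear Level, clear Mass, clear Count, incr Count,
     Loop (less Zero Count)
       (block [count_next_level,
          Cond (less Zero Count) (block [plus_to Mass Count, incr Level]) Skip]),
     Cond (less Mass Total) Fail Skip, Cond (less Total Mass) Fail Skip,
     Cond (Sweep (Emit Level)) Skip (Cond (Look (\<lambda>_. (Stay, True, Some False))) Skip Skip)]"

lemma runs_seek:
  assumes "\<rho> r \<le> Suc (length w)" "Suc (length w) < 2 ^ L" "r \<noteq> Counter"
    "runs w L out K (\<rho>(Counter := \<rho> r), \<rho> r, o') m"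
  shows "runs w L out (seek r # K) (\<rho>, h, o') m"
proof -
  let ?I = "\<lambda>k \<rho>' h'. \<rho>' = \<rho>(Counter := k) \<and> h' = k"
  have "runs w L out (Loop (less Counter r) (block [incr Counter, advance]) # Skip # K)
     (\<rho>(Counter := 0), 0, o') m"
  proof (rule runs_for[where I = ?I and n = "\<rho> r"])
    fix k \<rho>' h' K assume *: "?I k \<rho>' h'" "k < \<rho> r"
      "\<And>\<rho>' h'. ?I (Suc k) \<rho>' h' \<Longrightarrow> runs w L out K (\<rho>', h', o') m"
    then have "Suc k < 2 ^ L" "\<not> length w < k" using assms by auto
    then show "runs w L out (block [incr Counter, advance] # K) (\<rho>', h', o') m"
      using * by (simp add: runs_simps clamp_def input_cell_not_Rend)
  qed (use assms in \<open>auto simp: runs_simps\<close>)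
  then show ?thesis
    unfolding seek_def by (simp add: runs_simps runs_rewind)
qed

section \<open>Walks ending at a vertex\<close>

text \<open>The predecessors along a walk ending at \<open>u\<close> are listed from \<open>u\<close> backwards.\<close>

fun back_walk :: "('a \<times> 'a) set \<Rightarrow> 'a \<Rightarrow> 'a list \<Rightarrow> bool" where
  "back_walk E u [] = True"
| "back_walk E u (v # vs) = ((v, u) \<in> E \<and> back_walk E v vs)"

lemma back_walk_trancl: "back_walk E u vs \<Longrightarrow> v \<in> set vs \<Longrightarrow> (v, u) \<in> E\<^sup>+"
  by (induction vs arbitrary: u) (auto intro: trancl_into_trancl)

lemma back_walk_distinct:
  assumes "acyclic E"
  shows "back_walk E u vs \<Longrightarrow> distinct (u # vs)"
proof (induction vs arbitrary: u)
  case (Cons v vs)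
  have "u \<notin> set (v # vs)"
    using back_walk_trancl[OF Cons.prems] assms by (metis acyclic_def)
  then show ?case using Cons by auto
qed simp

lemma back_walk_subset: "E \<subseteq> V \<times> V \<Longrightarrow> back_walk E u vs \<Longrightarrow> set vs \<subseteq> V"
  by (induction vs arbitrary: u) auto

lemma back_walk_length:
  assumes "acyclic E" "E \<subseteq> V \<times> V" "finite V" "u \<in> V" "back_walk E u vs"
  shows "length vs < card V"
proof -
  have "length (u # vs) = card (set (u # vs))"
    using back_walk_distinct[OF assms(1,5)] distinct_card by metis
  also have "\<dots> \<le> card V"
    using assms back_walk_subset[OF assms(2,5)] by (intro card_mono) auto
  finally show ?thesis by simp
qed

text \<open>The form in which the graph enters the counting: uniqueness holds among all walks ending
  at \<open>u\<close>, with no condition on the first vertex, because the program guesses walks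
  without prescribing where they begin.\<close>

locale max_unique_walks =
  fixes E :: "(nat \<times> nat) set" and n :: nat
  assumes E_sub: "E \<subseteq> {..<n} \<times> {..<n}" and wf_E: "wf E" and n_pos: "0 < n"
    and unique: "u < n \<Longrightarrow>
      \<exists>!vs. back_walk E u vs \<and> (\<forall>ws. back_walk E u ws \<longrightarrow> length ws \<le> length vs)"
begin

section \<open>Depths of vertices and their sums\<close>

definition walks :: "nat \<Rightarrow> nat list set" where
  "walks u = {vs. back_walk E u vs}"

definition depth :: "nat \<Rightarrow> nat" where
  "depth u = Max (length ` walks u)"

definition capped_sum :: "nat \<Rightarrow> nat \<Rightarrow> nat" where
  "capped_sum k y = (\<Sum>z<y. min (depth z) k)"

definition depth_sum :: "nat \<Rightarrow> nat" where
  "depth_sum y = (\<Sum>z<y. depth z)"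

lemma E_less: "(v, u) \<in> E \<Longrightarrow> v < n \<and> u < n"
  using E_sub by auto

lemma length_walk_less: "vs \<in> walks u \<Longrightarrow> u < n \<Longrightarrow> length vs < n"
  using back_walk_length[OF wf_acyclic[OF wf_E] E_sub, of u vs] by (simp add: walks_def)

lemma finite_walks: "u < n \<Longrightarrow> finite (walks u)"
  by (rule finite_subset[OF _ finite_lists_length_le[of "{..<n}" n]])
    (auto simp: less_imp_le length_walk_less walks_def dest: back_walk_subset[OF E_sub])

lemma Nil_walk: "[] \<in> walks u"
  by (simp add: walks_def)

lemma length_le_depth: "u < n \<Longrightarrow> vs \<in> walks u \<Longrightarrow> length vs \<le> depth u"
  unfolding depth_def by (intro Max_ge finite_imageI finite_walks imageI)

lemma depth_walk:
  assumes "u < n"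
  obtains vs where "vs \<in> walks u" "length vs = depth u"
proof -
  have "depth u \<in> length ` walks u"
    unfolding depth_def using assms Nil_walk by (intro Max_in finite_imageI finite_walks) auto
  then show ?thesis using that by auto
qed

lemma depth_less: "u < n \<Longrightarrow> depth u < n"
  using depth_walk length_walk_less by metis

lemma card_deepest_walks:
  assumes "u < n"
  shows "card {vs \<in> walks u. length vs = depth u} = 1"
proof -
  have "vs \<in> walks u \<and> length vs = depth u \<longleftrightarrow>
      back_walk E u vs \<and> (\<forall>ws. back_walk E u ws \<longrightarrow> length ws \<le> length vs)" for vs
  proof -
    obtain us where us: "us \<in> walks u" "length us = depth u" using depth_walk[OF assms] .
    show ?thesis
    proof
      assume "vs \<in> walks u \<and> length vs = depth u"
      then show "back_walk E u vs \<and> (\<forall>ws. back_walk E u ws \<longrightarrow> length ws \<le> length vs)"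
        using length_le_depth[OF assms] by (simp add: walks_def)
    next
      assume *: "back_walk E u vs \<and> (\<forall>ws. back_walk E u ws \<longrightarrow> length ws \<le> length vs)"
      then have "vs \<in> walks u" "depth u \<le> length vs" using us by (auto simp: walks_def)
      then show "vs \<in> walks u \<and> length vs = depth u"
        using length_le_depth[OF assms] by (simp add: le_antisym)
    qed
  qed
  then have "\<exists>!vs. vs \<in> walks u \<and> length vs = depth u" using unique[OF assms] by simp
  then obtain vs where "{vs \<in> walks u. length vs = depth u} = {vs}" by blast
  then show ?thesis by simp
qed

lemma walks_unfold: "walks u = insert [] (\<Union>v\<in>{v \<in> {..<n}. (v, u) \<in> E}. (#) v ` walks v)"
proof -
  have "vs \<in> walks u \<longleftrightarrow> vs \<in> insert [] (\<Union>v\<in>{v \<in> {..<n}. (v, u) \<in> E}. (#) v ` walks v)" for vs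
    using E_less by (cases vs) (auto simp: walks_def)
  then show ?thesis by blast
qed

text \<open>The recursion mirrors one round of \<open>guess_walk\<close>: either the walk stops
  here, or a predecessor \<open>v\<close> is chosen and the length grows by one.\<close>

lemma sum_walks:
  fixes g :: "nat \<Rightarrow> nat"
  assumes "u < n"
  shows "(\<Sum>vs\<in>walks u. g (length vs)) =
    g 0 + (\<Sum>v<n. if (v, u) \<in> E then \<Sum>vs\<in>walks v. g (Suc (length vs)) else 0)"
proof -
  let ?A = "{v \<in> {..<n}. (v, u) \<in> E}"
  have "(\<Sum>vs\<in>walks u. g (length vs)) = g 0 + (\<Sum>vs\<in>(\<Union>v\<in>?A. (#) v ` walks v). g (length vs))"
    by (subst walks_unfold, subst sum.insert) (auto simp: finite_walks)
  also have "(\<Sum>vs\<in>(\<Union>v\<in>?A. (#) v ` walks v). g (length vs)) =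
      (\<Sum>v\<in>?A. \<Sum>vs\<in>(#) v ` walks v. g (length vs))"
    by (subst sum.UNION_disjoint) (auto simp: finite_walks)
  also have "\<dots> = (\<Sum>v\<in>?A. \<Sum>vs\<in>walks v. g (Suc (length vs)))"
    by (rule sum.cong[OF refl], subst sum.reindex) auto
  also have "\<dots> = (\<Sum>v<n. if (v, u) \<in> E then \<Sum>vs\<in>walks v. g (Suc (length vs)) else 0)"
    by (subst sum.inter_filter) auto
  finally show ?thesis .
qed

lemma Suc_le_depth:
  assumes "x < n"
  shows "Suc k \<le> depth x \<longleftrightarrow> (\<exists>z<n. (z, x) \<in> E \<and> k \<le> depth z)"
proof
  assume k: "Suc k \<le> depth x"
  obtain vs where vs: "vs \<in> walks x" "length vs = depth x" using depth_walk[OF assms] by blast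
  with k obtain z zs where z: "vs = z # zs" by (cases vs) auto
  with vs have "(z, x) \<in> E" "zs \<in> walks z" by (auto simp: walks_def)
  moreover from this have "z < n" "length zs \<le> depth z" using E_less length_le_depth by blast+
  ultimately show "\<exists>z<n. (z, x) \<in> E \<and> k \<le> depth z" using k vs z by fastforce
next
  assume "\<exists>z<n. (z, x) \<in> E \<and> k \<le> depth z"
  then obtain z where z: "z < n" "(z, x) \<in> E" "k \<le> depth z" by blast
  obtain zs where zs: "zs \<in> walks z" "length zs = depth z" using depth_walk[OF z(1)] by blast
  then have "z # zs \<in> walks x" using z by (simp add: walks_def)
  from length_le_depth[OF assms this] show "Suc k \<le> depth x" using z zs by simp
qed

text \<open>Raising the cap from \<open>k\<close> to \<open>k + 1\<close> adds 1 to
  \<open>min (depth x) k\<close> exactly for the vertices of depth above \<open>k\<close>.\<close>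

lemma capped_sum_Suc:
  "capped_sum (Suc k) y = capped_sum k y + card {x \<in> {..<y}. Suc k \<le> depth x}"
proof (induction y)
  case (Suc y)
  have "{x \<in> {..<Suc y}. Suc k \<le> depth x} =
      (if Suc k \<le> depth y then insert y {x \<in> {..<y}. Suc k \<le> depth x}
       else {x \<in> {..<y}. Suc k \<le> depth x})"
    by (auto simp: less_Suc_eq)
  then show ?case using Suc by (auto simp: capped_sum_def)
qed (simp add: capped_sum_def)

lemma capped_sum_le: "capped_sum k y \<le> depth_sum y"
  unfolding capped_sum_def depth_sum_def by (intro sum_mono) auto

lemma capped_sum_eq: "(\<And>x. x < y \<Longrightarrow> depth x \<le> k) \<Longrightarrow> capped_sum k y = depth_sum y"
  unfolding capped_sum_def depth_sum_def by (intro sum.cong) auto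

lemma sums_mono: "y \<le> n \<Longrightarrow> capped_sum k y \<le> capped_sum k n \<and> depth_sum y \<le> depth_sum n"
  unfolding capped_sum_def depth_sum_def by (intro conjI sum_mono2) auto

lemma depth_sum_le: "depth_sum n \<le> n * n"
proof -
  have "depth_sum n \<le> (\<Sum>z<n. n)"
    unfolding depth_sum_def by (intro sum_mono) (simp add: depth_less less_imp_le)
  then show ?thesis by simp
qed

text \<open>
  Partial sums never exceed their targets, and only the longest walk keeps up with both of them.
\<close>

lemma sum_longest:
  assumes "y < n" "p \<le> capped_sum k y" "q \<le> depth_sum y"
  shows "(\<Sum>vs\<in>walks y. if p + min (length vs) k = capped_sum k (Suc y) \<and>
      q + length vs = depth_sum (Suc y) then m else 0) =
    (if p = capped_sum k y \<and> q = depth_sum y then m else (0 :: nat))" (is "?l = ?r")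
proof -
  have "p + min (length vs) k = capped_sum k (Suc y) \<and> q + length vs = depth_sum (Suc y) \<longleftrightarrow>
      length vs = depth y \<and> p = capped_sum k y \<and> q = depth_sum y" if "vs \<in> walks y" for vs
    using length_le_depth[OF assms(1) that] assms by (auto simp: capped_sum_def depth_sum_def)
  then have "?l = (\<Sum>vs\<in>walks y. if length vs = depth y then ?r else 0)"
    by (intro sum.cong) auto
  also have "\<dots> = card {vs \<in> walks y. length vs = depth y} * ?r"
    using finite_walks[OF assms(1)] by (simp add: sum.inter_filter[symmetric])
  finally show ?thesis using card_deepest_walks[OF assms(1)] by simp
qed

end

section \<open>Correctness of the program\<close>

locale max_unique_input = max_unique_walks +
  fixes w :: "bool list" and L base :: nat and out :: "bool list"
  assumes cell: "v < n \<Longrightarrow> u < n \<Longrightarrow> input_cell w (base + u + v * n) = Bit ((v, u) \<in> E)"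
    and size: "base + n * n \<le> Suc (length w)" and width: "Suc (length w) < 2 ^ L"
begin

lemma address_less: "v < n \<Longrightarrow> u < n \<Longrightarrow> base + u + v * n < Suc (length w)"
proof -
  assume "v < n" "u < n"
  then have "u + v * n < Suc v * n" "Suc v * n \<le> n * n"
    by (simp, intro mult_le_mono1) simp
  then show ?thesis using size by linarith
qed

lemma address_less_power: "v < n \<Longrightarrow> u < n \<Longrightarrow> base + u + v * n < 2 ^ L"
  using address_less width by fastforce

text \<open>Registers made for head positions can also hold sums of depths: the adjacency matrix
  alone occupies \<open>n * n\<close> cells.\<close>

lemma square_less_power: "n * n < 2 ^ L"
  using size width by linarith

lemma n_less_power: "n < 2 ^ L"
  using square_less_power n_pos by (metis le_square le_less_trans)

lemma base_less_power: "base < 2 ^ L"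
  using size width by linarith

text \<open>\<open>g v'\<close> counts the executions that go on with the choice \<open>v'\<close>.
  The forks of \<open>Star\<close> add up to a sum over \<open>v'\<close>, which is empty once
  \<open>Pred\<close> reaches \<open>n\<close>.\<close>

lemma runs_choose_pred:
  assumes "v < n" "u < n" "\<rho> Size = n" "\<rho> Pred = v" "\<rho> PredAddress = base + u + v * n"
    and "\<And>v'. v \<le> v' \<Longrightarrow> v' < n \<Longrightarrow>
      runs w L out K (\<rho>(Pred := v', PredAddress := base + u + v' * n), h, o') (g v')"
  shows "runs w L out (choose_pred # K) (\<rho>, h, o') (\<Sum>v'=v..<n. g v')"
  using assms
proof (induction "n - v" arbitrary: v \<rho>)
  case (Suc d)
  let ?B = "block [incr Pred, Cond (less Pred Size) Skip Fail, plus_to PredAddress Size]"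
  have "\<rho>(Pred := v, PredAddress := base + u + v * n) = \<rho>"
    using Suc.prems(4,5) by (auto simp: fun_upd_apply)
  then have 1: "runs w L out K (\<rho>, h, o') (g v)"
    using Suc.prems(1) Suc.prems(6)[of v] by simp
  have sv: "Suc v < 2 ^ L" using Suc.prems(1) n_less_power by linarith
  have 2: "runs w L out (?B # choose_pred # K) (\<rho>, h, o') (\<Sum>v'=Suc v..<n. g v')"
  proof (cases "Suc v < n")
    case True
    let ?\<rho> = "\<rho>(Pred := Suc v, PredAddress := base + u + Suc v * n)"
    have "?\<rho>(Pred := v', PredAddress := a) = \<rho>(Pred := v', PredAddress := a)" for v' a
      by (auto simp: fun_upd_apply)
    then have "runs w L out (choose_pred # K) (?\<rho>, h, o') (\<Sum>v'=Suc v..<n. g v')"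
      using Suc.hyps(2) Suc.prems True by (intro Suc.hyps(1)) auto
    moreover have "base + u + v * n + n < 2 ^ L"
      using address_less_power[OF True Suc.prems(2)] by (simp add: algebra_simps)
    ultimately show ?thesis
      using Suc.prems True sv by (simp add: runs_simps algebra_simps)
  next
    case False
    then show ?thesis using Suc.prems sv by (simp add: runs_simps)
  qed
  have "(\<Sum>v'=v..<n. g v') = g v + (\<Sum>v'=Suc v..<n. g v')"
    using Suc.prems(1) by (simp add: sum.atLeast_Suc_lessThan)
  then show ?case
    using runs_Star[OF 1 2[unfolded choose_pred_def]] unfolding choose_pred_def by simp
qed simp

abbreviation scratch :: "reg set" where
  "scratch \<equiv> {Pred, PredAddress, Current, Length, Counter}"

text \<open>\<open>Star\<close> terminates here because the graph is acyclic, hence the induction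
  along \<open>E\<close>. The weight \<open>g\<close> depends on the walk only through its length:
  the other scratch registers are forgotten afterwards.\<close>

lemma runs_guess_walk:
  assumes "u < n" "\<rho> Size = n" "\<rho> Base = base" "\<rho> Current = u" "\<rho> Length = l"
    and "\<And>vs. vs \<in> walks u \<Longrightarrow> l + length vs < 2 ^ L"
    and "\<And>vs \<rho>' h'. vs \<in> walks u \<Longrightarrow> (\<And>r. r \<notin> scratch \<Longrightarrow> \<rho>' r = \<rho> r) \<Longrightarrow>
      \<rho>' Length = l + length vs \<Longrightarrow> runs w L out K (\<rho>', h', o') (g (l + length vs))"
  shows "runs w L out (guess_walk # K) (\<rho>, h, o') (\<Sum>vs\<in>walks u. g (l + length vs))"
  using wf_E assms
proof (induction u arbitrary: \<rho> h l rule: wf_induct_rule)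
  case (less u)
  let ?f = "\<lambda>v. if (v, u) \<in> E then \<Sum>vs\<in>walks v. g (l + Suc (length vs)) else 0"
  let ?C = "block [seek PredAddress, Cond read_bit Skip Fail, clear Current,
    plus_to Current Pred, incr Length]"
  let ?\<rho> = "\<rho>(Pred := 0, PredAddress := base + u)"
  have u: "u < 2 ^ L" "base + u < 2 ^ L"
    using less.prems(1) n_less_power address_less_power[OF n_pos, of u] by auto
  have 1: "runs w L out K (\<rho>, h, o') (g l)"
    using less.prems(7)[OF Nil_walk, of \<rho> h] less.prems(5) by simp
  have "runs w L out (choose_pred # ?C # guess_walk # K) (?\<rho>, h, o') (\<Sum>v=0..<n. ?f v)"
  proof (rule runs_choose_pred)
    fix v assume v: "v < n"
    let ?a = "base + u + v * n"
    let ?\<rho>1 = "\<rho>(Pred := v, PredAddress := ?a)"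
    have a: "?a \<le> Suc (length w)" using address_less[OF v less.prems(1)] by simp
    have vL: "v < 2 ^ L" using v n_less_power by simp
    have "runs w L out (Cond read_bit Skip Fail # block [clear Current, plus_to Current Pred,
        incr Length] # guess_walk # K) (?\<rho>1(Counter := ?a), ?a, o') (?f v)"
    proof (cases "(v, u) \<in> E")
      case True
      then have ext: "v # vs \<in> walks u" if "vs \<in> walks v" for vs
        using that by (simp add: walks_def)
      have l: "Suc l < 2 ^ L" using less.prems(6)[OF ext[OF Nil_walk]] by simp
      let ?\<rho>2 = "\<rho>(Pred := v, PredAddress := ?a, Counter := ?a, Current := v, Length := Suc l)"
      have "runs w L out (guess_walk # K) (?\<rho>2, ?a, o') (\<Sum>vs\<in>walks v. g (Suc l + length vs))"
      proof (rule less.IH[OF True])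
        fix vs assume vs: "vs \<in> walks v"
        show "Suc l + length vs < 2 ^ L" using less.prems(6)[OF ext[OF vs]] by simp
        fix \<rho>' h' assume "\<And>r. r \<notin> scratch \<Longrightarrow> \<rho>' r = ?\<rho>2 r" "\<rho>' Length = Suc l + length vs"
        then show "runs w L out K (\<rho>', h', o') (g (Suc l + length vs))"
          using less.prems(7)[OF ext[OF vs], of \<rho>' h'] by simp
      qed (use v less.prems in auto)
      then show ?thesis
        using True cell[OF v less.prems(1)] less.prems(5) l vL
        by (simp add: runs_simps clamp_def)
    next
      case False
      then show ?thesis
        using cell[OF v less.prems(1)] by (simp add: runs_simps clamp_def)
    qed
    then have "runs w L out (?C # guess_walk # K) (?\<rho>1, h, o') (?f v)"
      unfolding block.simps(2)[of "seek PredAddress"] runs_Seq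
      using a width by (intro runs_seek) (auto simp: runs_Seq)
    then show "runs w L out (?C # guess_walk # K)
        (?\<rho>(Pred := v, PredAddress := base + u + v * n), h, o') (?f v)"
      by (simp add: fun_upd_twist)
  qed (use less.prems n_pos in auto)
  then have "runs w L out (block [clear Pred, clear PredAddress, plus_to PredAddress Base,
     plus_to PredAddress Current, choose_pred, seek PredAddress, Cond read_bit Skip Fail,
     clear Current, plus_to Current Pred, incr Length] # guess_walk # K) (\<rho>, h, o') (\<Sum>v<n. ?f v)"
    using u less.prems base_less_power by (simp add: runs_simps lessThan_atLeast0)
  from runs_Star[OF 1 this[unfolded guess_walk_def]] show ?case
    using sum_walks[OF less.prems(1), of "\<lambda>j. g (l + j)"]
    by (simp add: guess_walk_def)
qed

text \<open>\<open>Address\<close> is claimed only modulo \<open>2 ^ L\<close>: after the last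
  source it points behind the matrix and may have wrapped around, but it is then no longer
  read.\<close>

lemma runs_visit:
  assumes "y < n" "x < n" "\<rho> Size = n" "\<rho> Base = base" "\<rho> Level = k" "\<rho> Source = y"
    "\<rho> Address = base + x + y * n" "\<rho> CappedSum = p" "\<rho> LengthSum = q"
    and "\<And>vs. vs \<in> walks y \<Longrightarrow> p + min (length vs) k < 2 ^ L \<and> q + length vs < 2 ^ L"
    and "\<And>vs \<rho>' h'. vs \<in> walks y \<Longrightarrow>
      (\<And>r. r \<notin> scratch \<union> {LengthSum, CappedSum, Found, Address, Source} \<Longrightarrow> \<rho>' r = \<rho> r) \<Longrightarrow>
      \<rho>' LengthSum = q + length vs \<Longrightarrow> \<rho>' CappedSum = p + min (length vs) k \<Longrightarrow>
      \<rho>' Found = (if k \<le> length vs \<and> (y, x) \<in> E then 1 else \<rho> Found) \<Longrightarrow>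
      \<rho>' Address = (base + x + Suc y * n) mod 2 ^ L \<Longrightarrow> \<rho>' Source = Suc y \<Longrightarrow>
      runs w L out K (\<rho>', h', o') (g (length vs))"
  shows "runs w L out (visit # K) (\<rho>, h, o') (\<Sum>vs\<in>walks y. g (length vs))"
proof -
  have y: "y < 2 ^ L" "Suc y < 2 ^ L" using assms(1) n_less_power by auto
  \<comment> \<open>With \<open>L = 0\<close> the increment of \<open>Found\<close> would wrap
    around to 0.\<close>
  have one: "0 < L" using y(2) by (cases L) auto
  let ?\<rho> = "\<rho>(Current := y, Length := 0)"
  let ?F = "Cond read_bit (block [clear Found, incr Found]) Skip"
  let ?D = "block [plus_to CappedSum Level, seek Address, ?F]"
  let ?C = "block [plus_to LengthSum Length, Cond (less Length Level) (plus_to CappedSum Length) ?D,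
     plus_to Address Size, incr Source]"
  have "runs w L out (guess_walk # ?C # K) (?\<rho>, h, o') (\<Sum>vs\<in>walks y. g (0 + length vs))"
  proof (rule runs_guess_walk)
    fix vs \<rho>1 h1
    assume vs: "vs \<in> walks y" and "\<And>r. r \<notin> scratch \<Longrightarrow> \<rho>1 r = ?\<rho> r"
      and len: "\<rho>1 Length = 0 + length vs"
    then have fr: "\<rho>1 r = \<rho> r" if "r \<notin> scratch" for r using that by auto
    note K = assms(11)[OF vs]
    note bounds = assms(10)[OF vs]
    show "runs w L out (?C # K) (\<rho>1, h1, o') (g (0 + length vs))"
    proof (cases "length vs < k")
      case True
      then show ?thesis
        using y bounds len fr assms(1-9)
        by (simp add: runs_simps) (intro K; simp add: algebra_simps)
    next
      case False
      let ?a = "base + x + y * n"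
      let ?\<rho>2 = "\<rho>1(LengthSum := q + length vs, CappedSum := p + k)"
      have a: "?a \<le> Suc (length w)" using address_less[OF assms(1,2)] by simp
      have "runs w L out (block [?F] # block [plus_to Address Size, incr Source] # K)
          (?\<rho>2(Counter := ?a), ?a, o') (g (length vs))"
        using y one False bounds len fr assms(1-9) cell[OF assms(1,2)]
        by (cases "(y, x) \<in> E"; simp add: runs_simps clamp_def; intro K; simp add: algebra_simps)
      then have "runs w L out (seek Address # block [?F] # block [plus_to Address Size, incr Source] # K)
          (?\<rho>2, h1, o') (g (length vs))"
        using a width assms(7) fr by (intro runs_seek) auto
      then show ?thesis
        using False bounds len fr assms(1-9) by (simp add: runs_simps)
    qed
  next
    fix vs assume "vs \<in> walks y"
    then show "0 + length vs < 2 ^ L" using length_walk_less[of vs y] assms(1) n_less_power by simp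
  qed (use assms in auto)
  then show ?thesis
    unfolding visit_def using y assms(6) by (simp add: runs_simps)
qed

end

context max_unique_input
begin

abbreviation globals :: "reg set" where
  "globals \<equiv> {Zero, Size, Base, Total, Level, Mass, Count, Vertex}"

abbreviation outer_globals :: "reg set" where
  "outer_globals \<equiv> {Zero, Size, Base, Total, Level, Mass}"

lemma sums_less_power:
  assumes "y \<le> n" shows "capped_sum k y < 2 ^ L" "depth_sum y < 2 ^ L"
proof -
  have "capped_sum k y \<le> depth_sum y" "depth_sum y \<le> n * n"
    using capped_sum_le sums_mono[OF assms] depth_sum_le by (auto intro: order_trans)
  then show "capped_sum k y < 2 ^ L" "depth_sum y < 2 ^ L"
    using square_less_power by linarith+
qed

text \<open>
  The count is \<open>m\<close> for the right guess of the total depth; for a wrong one only \<open>m = 0\<close> is claimed,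
  which is all that is needed because the final comparison then rejects.
\<close>

lemma runs_scan_loop:
  assumes "x < n" "y \<le> n" "\<rho> Size = n" "\<rho> Base = base" "\<rho> Level = k" "\<rho> Mass = capped_sum k n"
    "\<rho> Total = t" "t = depth_sum n \<or> m = 0" "\<rho> Source = y"
    "\<rho> Address = (base + x + y * n) mod 2 ^ L"
    "\<rho> CappedSum = p" "p \<le> capped_sum k y" "\<rho> LengthSum = q" "q \<le> depth_sum y"
    "p = capped_sum k y \<Longrightarrow> \<rho> Found = of_bool (\<exists>z<y. (z, x) \<in> E \<and> k \<le> depth z)"
    and "\<And>\<rho>' h'. (\<And>r. r \<in> globals \<Longrightarrow> \<rho>' r = \<rho> r) \<Longrightarrow>
      \<rho>' Found = of_bool (Suc k \<le> depth x) \<Longrightarrow> runs w L out K (\<rho>', h', o') m"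
  shows "runs w L out (Loop (less Source Size) visit #
      block [Cond (less CappedSum Mass) Fail Skip, Cond (less LengthSum Total) Fail Skip] # K)
    (\<rho>, h, o') (if p = capped_sum k y \<and> q = depth_sum y then m else 0)"
  using assms(2,3-7,9-)
proof (induction y arbitrary: \<rho> h p q rule: inc_induct)
  case base
  have K: "p = capped_sum k n \<Longrightarrow> runs w L out K (\<rho>, h, o') m"
    using base.prems Suc_le_depth[OF assms(1), of k] by simp
  show ?case
  \<comment> \<open>If \<open>p\<close> falls short, the first test rejects. Otherwise a correct
    \<open>t\<close> makes the second test reject unless \<open>q\<close> is the full sum, and for
    \<open>m = 0\<close> either outcome counts 0.\<close>
  proof (cases "p = capped_sum k n")
    case True
    then show ?thesis
      using base.prems K assms(8) by (auto simp: runs_Loop runs_simps not_less)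
  next
    case False
    then show ?thesis using base.prems by (simp add: runs_Loop runs_simps)
  qed
next
  case (step y)
  let ?T = "block [Cond (less CappedSum Mass) Fail Skip, Cond (less LengthSum Total) Fail Skip]"
  \<comment> \<open>The number of accepting executions after a walk of length \<open>l\<close> has
    been guessed for \<open>y\<close>, as the induction hypothesis for \<open>Suc y\<close> gives
    it.\<close>
  let ?g = "\<lambda>l. if p + min l k = capped_sum k (Suc y) \<and> q + l = depth_sum (Suc y) then m else 0"
  have sums: "capped_sum k (Suc y) = capped_sum k y + min (depth y) k"
    "depth_sum (Suc y) = depth_sum y + depth y" by (simp_all add: capped_sum_def depth_sum_def)
  have y: "y < n" by fact
  have "runs w L out (visit # Loop (less Source Size) visit # ?T # K) (\<rho>, h, o')
      (\<Sum>vs\<in>walks y. ?g (length vs))"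
  proof (rule runs_visit)
    show "y < n" "x < n" by fact+
    show "\<rho> Address = base + x + y * n"
      using step.prems address_less_power[OF y assms(1)] by simp
  next
    fix vs assume vs: "vs \<in> walks y"
    have l: "length vs \<le> depth y" using length_le_depth[OF y vs] .
    then have "p + min (length vs) k \<le> capped_sum k (Suc y)" "q + length vs \<le> depth_sum (Suc y)"
      using step.prems sums by (simp_all add: add_mono min.coboundedI1)
    then show "p + min (length vs) k < 2 ^ L \<and> q + length vs < 2 ^ L"
      using sums_less_power[of "Suc y"] y by (meson Suc_leI le_less_trans)
  next
    fix vs \<rho>' h'
    assume vs: "vs \<in> walks y"
      and fr: "\<And>r. r \<notin> scratch \<union> {LengthSum, CappedSum, Found, Address, Source} \<Longrightarrow> \<rho>' r = \<rho> r"
      and \<rho>': "\<rho>' LengthSum = q + length vs" "\<rho>' CappedSum = p + min (length vs) k"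
        "\<rho>' Found = (if k \<le> length vs \<and> (y, x) \<in> E then 1 else \<rho> Found)"
        "\<rho>' Address = (base + x + Suc y * n) mod 2 ^ L" "\<rho>' Source = Suc y"
    have l: "length vs \<le> depth y" using length_le_depth[OF y vs] .
    show "runs w L out (Loop (less Source Size) visit # ?T # K) (\<rho>', h', o') (?g (length vs))"
    proof (rule step.IH)
      show "p + min (length vs) k \<le> capped_sum k (Suc y)" "q + length vs \<le> depth_sum (Suc y)"
        using step.prems sums l by (simp_all add: add_mono min.coboundedI1)
      assume eq: "p + min (length vs) k = capped_sum k (Suc y)"
      then have p: "p = capped_sum k y" "min (length vs) k = min (depth y) k"
        using step.prems sums l by auto
      \<comment> \<open>Equal capped lengths decide whether the depth reaches \<open>k\<close>, even
        if the guessed walk is not a longest one; the guess of the total does not enter.\<close>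
      then have "k \<le> length vs \<longleftrightarrow> k \<le> depth y" by auto
      then show "\<rho>' Found = of_bool (\<exists>z<Suc y. (z, x) \<in> E \<and> k \<le> depth z)"
        using step.prems(12)[OF p(1)] \<rho>'(3) by (auto simp: less_Suc_eq)
    next
      fix \<rho>'' h'' assume "\<And>r. r \<in> globals \<Longrightarrow> \<rho>'' r = \<rho>' r" "\<rho>'' Found = of_bool (Suc k \<le> depth x)"
      then show "runs w L out K (\<rho>'', h'', o') m"
        using fr by (intro step.prems(13)) auto
    qed (use step.prems fr \<rho>' in auto)
  qed (use step.prems in auto)
  \<comment> \<open>At most one walk has nonzero weight, the unique longest one, so the guesses do
    not multiply the count.\<close>
  also have "(\<Sum>vs\<in>walks y. ?g (length vs)) = (if p = capped_sum k y \<and> q = depth_sum y then m else 0)"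
    using sum_longest[OF y] step.prems by simp
  finally show ?case using step.prems y by (subst runs_Loop) simp
qed

text \<open>The partial sums and their targets all start at 0, so the whole count \<open>m\<close>
  survives: despite its guesses, the scan acts on the continuation like a deterministic command that
  sets \<open>Found\<close>.\<close>

lemma runs_scan_sources:
  assumes "x < n" "\<rho> Size = n" "\<rho> Base = base" "\<rho> Level = k" "\<rho> Mass = capped_sum k n"
    "\<rho> Total = t" "t = depth_sum n \<or> m = 0" "\<rho> Vertex = x"
    and "\<And>\<rho>' h'. \<forall>r \<in> globals. \<rho>' r = \<rho> r \<Longrightarrow>
      \<rho>' Found = of_bool (Suc k \<le> depth x) \<Longrightarrow> runs w L out K (\<rho>', h', o') m"
  shows "runs w L out (scan_sources # K) (\<rho>, h, o') m"
proof -
  let ?\<rho> = "\<rho>(Found := 0, CappedSum := 0, LengthSum := 0, Source := 0, Address := base + x)"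
  have x: "base + x < 2 ^ L" using address_less_power[OF n_pos assms(1)] by simp
  have "runs w L out (Loop (less Source Size) visit #
      block [Cond (less CappedSum Mass) Fail Skip, Cond (less LengthSum Total) Fail Skip] # K)
    (?\<rho>, h, o') (if 0 = capped_sum k 0 \<and> 0 = depth_sum 0 then m else 0)"
  proof (rule runs_scan_loop[where t = t, OF assms(1)])
    fix \<rho>' h' assume fr: "\<And>r. r \<in> globals \<Longrightarrow> \<rho>' r = ?\<rho> r"
      and f: "\<rho>' Found = of_bool (Suc k \<le> depth x)"
    have "\<forall>r \<in> globals. \<rho>' r = \<rho> r" by (simp add: fr)
    then show "runs w L out K (\<rho>', h', o') m" using f by (rule assms(9))
  qed (use assms(2-8) x in simp_all)
  then show ?thesis
    unfolding scan_sources_def using x assms(2-8) base_less_power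
    by (simp add: runs_simps capped_sum_def depth_sum_def)
qed

lemma runs_count_next_level:
  assumes "\<rho> Zero = 0" "\<rho> Size = n" "\<rho> Base = base" "\<rho> Level = k" "\<rho> Mass = capped_sum k n"
    "\<rho> Total = t" "t = depth_sum n \<or> m = 0"
    and "\<And>\<rho>' h'. \<forall>r \<in> outer_globals. \<rho>' r = \<rho> r \<Longrightarrow>
      \<rho>' Count = card {x. x < n \<and> Suc k \<le> depth x} \<Longrightarrow> runs w L out K (\<rho>', h', o') m"
  shows "runs w L out (count_next_level # K) (\<rho>, h, o') m"
proof -
  let ?I = "\<lambda>x \<rho>' (h' :: nat). (\<forall>r \<in> outer_globals. \<rho>' r = \<rho> r) \<and> \<rho>' Vertex = x \<and>
    \<rho>' Count = card {z. z < x \<and> Suc k \<le> depth z}"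
  have "runs w L out (Loop (less Vertex Size)
       (block [scan_sources, Cond (less Zero Found) (incr Count) Skip, incr Vertex]) # Skip # K)
     (\<rho>(Count := 0, Vertex := 0), h, o') m"
  proof (rule runs_for[where I = ?I and n = n])
    fix x \<rho>1 h1 K1
    assume I: "?I x \<rho>1 h1" and x: "x < n"
      and K1: "\<And>\<rho>' h'. ?I (Suc x) \<rho>' h' \<Longrightarrow> runs w L out K1 (\<rho>', h', o') m"
    let ?R = "block [Cond (less Zero Found) (incr Count) Skip, incr Vertex]"
    have "card {z. z < x \<and> Suc k \<le> depth z} \<le> card {..<x}" by (intro card_mono) auto
    then have c: "Suc (card {z. z < x \<and> Suc k \<le> depth z}) < 2 ^ L" "Suc x < 2 ^ L"
      using x n_less_power by auto
    have set: "{z. z < Suc x \<and> Suc k \<le> depth z} =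
        (if Suc k \<le> depth x then insert x {z. z < x \<and> Suc k \<le> depth z}
         else {z. z < x \<and> Suc k \<le> depth z})"
      by (auto simp: less_Suc_eq)
    have "runs w L out (scan_sources # ?R # K1) (\<rho>1, h1, o') m"
    proof (rule runs_scan_sources[where t = t, OF x])
      fix \<rho>2 h2
      assume fr: "\<forall>r \<in> globals. \<rho>2 r = \<rho>1 r" and f: "\<rho>2 Found = of_bool (Suc k \<le> depth x)"
      show "runs w L out (?R # K1) (\<rho>2, h2, o') m"
      proof (cases "Suc k \<le> depth x")
        case True
        then show ?thesis using fr f I c assms(1-6)
          by (simp add: runs_simps) (rule K1, simp add: set)
      next
        case False
        then show ?thesis using fr f I c assms(1-6)
          by (simp add: runs_simps) (rule K1, simp add: set)
      qed
    qed (use I assms in auto)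
    then show "runs w L out (block [scan_sources, Cond (less Zero Found) (incr Count) Skip,
        incr Vertex] # K1) (\<rho>1, h1, o') m"
      by (simp add: runs_simps)
  next
    fix \<rho>1 h1 assume "?I n \<rho>1 h1"
    then show "runs w L out (Skip # K) (\<rho>1, h1, o') m"
      unfolding runs_Skip by (intro assms(8)) auto
  qed (use assms in auto)
  then show ?thesis
    unfolding count_next_level_def by (simp add: runs_simps)
qed

end

lemma runs_guess_total:
  assumes "t < 2 ^ L" "\<rho> Total = t"
    and "\<And>t'. t \<le> t' \<Longrightarrow> t' < 2 ^ L \<Longrightarrow> runs w L out K (\<rho>(Total := t'), h, o') (g t')"
  shows "runs w L out (Star (Cond (Sweep (Incr Total)) Skip Fail) # K) (\<rho>, h, o') (\<Sum>t'=t..<2 ^ L. g t')"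
  using assms
proof (induction "2 ^ L - t" arbitrary: t \<rho>)
  case (Suc d)
  let ?B = "Cond (Sweep (Incr Total)) Skip Fail"
  have "\<rho>(Total := t) = \<rho>" using Suc.prems(2) by (simp add: fun_upd_idem)
  then have 1: "runs w L out K (\<rho>, h, o') (g t)"
    using Suc.prems(1) Suc.prems(3)[of t] by simp
  have 2: "runs w L out (?B # Star ?B # K) (\<rho>, h, o') (\<Sum>t'=Suc t..<2 ^ L. g t')"
  proof (cases "Suc t < 2 ^ L")
    case True
    have "runs w L out (Star ?B # K) (\<rho>(Total := Suc t), h, o') (\<Sum>t'=Suc t..<2 ^ L. g t')"
      using Suc.hyps(2) Suc.prems True by (intro Suc.hyps(1)) auto
    then show ?thesis using Suc.prems True by (simp add: runs_simps)
  next
    case False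
    then show ?thesis using Suc.prems by (simp add: runs_simps)
  qed
  have "(\<Sum>t'=t..<2 ^ L. g t') = g t + (\<Sum>t'=Suc t..<2 ^ L. g t')"
    using Suc.prems(1) by (simp add: sum.atLeast_Suc_lessThan)
  then show ?case using runs_Star[OF 1 2] by simp
qed simp

lemma input_cell_Suc: "j < length w \<Longrightarrow> input_cell w (Suc j) = Bit (w ! j)"
  by (simp add: input_cell_def)

text \<open>The offset \<open>n + s + t + 4\<close> consists of the left end marker and three unary
  numbers, each with its terminating 0.\<close>

lemma runs_parse:
  assumes w: "w = unary n @ unary s @ unary t @ rest" and L: "Suc (length w) < 2 ^ L"
    and K: "\<And>\<rho>'. \<rho>' Zero = 0 \<Longrightarrow> \<rho>' Size = n \<Longrightarrow> \<rho>' Base = n + s + t + 4 \<Longrightarrow>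
      runs w L out K (\<rho>', 0, o') m"
  shows "runs w L out (parse # K) (\<rho>, h, o') m"
proof -
  have len: "length w = n + s + t + 3 + length rest"
    by (simp add: w unary_def)
  have c1: "input_cell w (Suc 0 + i) = Bit True" if "i < n" for i
    using that len by (simp add: input_cell_Suc) (simp add: w unary_def nth_append)
  have c2: "input_cell w (Suc 0 + n) = Bit False"
    using len by (simp add: input_cell_Suc) (simp add: w unary_def nth_append)
  have c3: "input_cell w (Suc (Suc n) + i) = Bit True" if "i < s" for i
    using that len by (simp add: input_cell_Suc) (simp add: w unary_def nth_append)
  have c4: "input_cell w (Suc (Suc n) + s) = Bit False"
    using len by (simp add: input_cell_Suc) (simp add: w unary_def nth_append)
  have c5: "input_cell w (Suc (Suc (Suc n) + s) + i) = Bit True" if "i < t" for i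
    using that len by (simp add: input_cell_Suc) (simp add: w unary_def nth_append)
  have c6: "input_cell w (Suc (Suc (Suc n) + s) + t) = Bit False"
    using len by (simp add: input_cell_Suc) (simp add: w unary_def nth_append)
  let ?\<rho> = "\<rho>(Zero := 0, Size := n)"
  have "runs w L out K (?\<rho>(Base := n + s + t + 4), 0, o') m"
    by (rule K) simp_all
  then have "runs w L out (Loop step_left (incr Base) # block [] # K)
      (?\<rho>(Base := 0), n + s + t + 4, o') m"
    using L len by (intro runs_measure_position) (auto simp: runs_simps)
  then have "runs w L out (block [clear Base, Loop step_left (incr Base)] # K)
      (?\<rho>, Suc (Suc (Suc (Suc n) + s) + t), o') m"
    by (simp add: runs_simps eval_nat_numeral add_ac)
  from runs_skip_unary[of t w "Suc (Suc (Suc n) + s)", OF c5 c6 this]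
  have "runs w L out (block [Loop step_unary Skip, clear Base, Loop step_left (incr Base)] # K)
      (?\<rho>, Suc (Suc (Suc n) + s), o') m"
    by (simp add: runs_Seq)
  from runs_skip_unary[of s w "Suc (Suc n)", OF c3 c4 this]
  have 1: "runs w L out (block [Loop step_unary Skip, Loop step_unary Skip, clear Base,
      Loop step_left (incr Base)] # K) (\<rho>(Zero := 0, Size := 0 + n), Suc (Suc 0 + n), o') m"
    by (simp add: runs_Seq)
  have "runs w L out (Loop step_unary (incr Size) # block [Loop step_unary Skip,
      Loop step_unary Skip, clear Base, Loop step_left (incr Base)] # K)
      (\<rho>(Zero := 0, Size := 0), Suc 0, o') m"
    using c1 c2 1 L len by (intro runs_count_unary[where k = n]) auto
  then have "runs w L out (Loop step_left Skip # block [advance, clear Size,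
     Loop step_unary (incr Size), Loop step_unary Skip, Loop step_unary Skip,
     clear Base, Loop step_left (incr Base)] # K) (\<rho>(Zero := 0), h, o') m"
    by (intro runs_rewind) (simp add: runs_simps clamp_def input_cell_def)
  then show ?thesis
    unfolding parse_def by (simp add: runs_simps)
qed

context max_unique_input
begin

text \<open>Some depth always reaches \<open>Level\<close>, and on exit no depth exceeds it, so it
  ends as the maximal depth. Depths are below \<open>n\<close>, hence \<open>n - k\<close>
  decreases. On first entry \<open>Count\<close> counts no vertices, which is why only its value 0
  carries information.\<close>

lemma runs_level_loop:
  assumes "\<rho> Zero = 0" "\<rho> Size = n" "\<rho> Base = base" "\<rho> Total = t" "t = depth_sum n \<or> m = 0"
    "\<rho> Level = k" "\<rho> Mass = capped_sum k n"
    "\<rho> Count = 0 \<Longrightarrow> \<forall>x<n. depth x \<le> k" "\<exists>x<n. k \<le> depth x"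
    and K: "\<And>\<rho>' h' k'. \<rho>' Total = t \<Longrightarrow> \<rho>' Level = k' \<Longrightarrow> \<rho>' Mass = depth_sum n \<Longrightarrow>
      \<exists>x<n. k' \<le> depth x \<Longrightarrow> \<forall>x<n. depth x \<le> k' \<Longrightarrow> runs w L out K (\<rho>', h', o') m"
  shows "runs w L out (Loop (less Zero Count) (block [count_next_level,
          Cond (less Zero Count) (block [plus_to Mass Count, incr Level]) Skip]) # K) (\<rho>, h, o') m"
  using assms(1-4,6-9)
proof (induction "n - k" arbitrary: k \<rho> h rule: less_induct)
  case less
  let ?R = "Cond (less Zero Count) (block [plus_to Mass Count, incr Level]) Skip"
  let ?B = "block [count_next_level, ?R]"
  let ?Loop = "Loop (less Zero Count) ?B"
  have exit: "runs w L out (?Loop # K) (\<rho>', h', o') m"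
    if "\<rho>' Zero = 0" "\<rho>' Count = 0" "\<rho>' Total = t" "\<rho>' Level = k" "\<rho>' Mass = capped_sum k n"
      "\<forall>x<n. depth x \<le> k" for \<rho>' h'
    using that less.prems(8) K[of \<rho>' k h'] by (simp add: runs_Loop capped_sum_eq)
  show ?case
  proof (cases "\<rho> Count = 0")
    case True
    then show ?thesis using exit[of \<rho> h] less.prems by simp
  next
    case False
    have "runs w L out (count_next_level # block [?R] # ?Loop # K) (\<rho>, h, o') m"
    proof (rule runs_count_next_level[where t = t and k = k])
      fix \<rho>1 h1 assume fr: "\<forall>r \<in> outer_globals. \<rho>1 r = \<rho> r"
        and c: "\<rho>1 Count = card {x. x < n \<and> Suc k \<le> depth x}"
      show "runs w L out (block [?R] # ?Loop # K) (\<rho>1, h1, o') m"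
      proof (cases "\<rho>1 Count = 0")
        case True
        then have "\<forall>x<n. depth x \<le> k" using c by (auto simp: not_less_eq_eq)
        then show ?thesis using True fr less.prems exit[of \<rho>1 h1] by (simp add: runs_simps)
      next
        case False
        then have ex: "\<exists>x<n. Suc k \<le> depth x" using c by (auto simp: card_gt_0_iff)
        then have k: "Suc k < n" using depth_less by fastforce
        have m: "capped_sum (Suc k) n = capped_sum k n + \<rho>1 Count"
          using c by (simp add: capped_sum_Suc)
        have b: "capped_sum k n + \<rho>1 Count < 2 ^ L" "Suc k < 2 ^ L"
          using sums_less_power(1)[of n "Suc k"] k n_less_power m by simp_all
        have "runs w L out (?Loop # K)
            (\<rho>1(Mass := capped_sum (Suc k) n, Level := Suc k), h1, o') m"
          using fr less.prems ex k False by (intro less.hyps[of "Suc k"]) auto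
        then show ?thesis using False fr less.prems b m by (simp add: runs_simps)
      qed
    qed (use less.prems assms(5) in auto)
    then show ?thesis
      using False less.prems by (subst runs_Loop) (simp add: runs_simps)
  qed
qed

lemma runs_longest_path_program:
  assumes "w = unary n @ unary s @ unary t @ rest" "base = n + s + t + 4"
    and K: "\<exists>x<n. k \<le> depth x" "\<forall>x<n. depth x \<le> k" and out: "out = binary k"
  shows "runs w L out [longest_path_program] (\<rho>, h, []) 1"
proof -
  let ?E = "Cond (Sweep (Emit Level)) Skip (Cond (Look (\<lambda>_. (Stay, True, Some False))) Skip Skip)"
  let ?T = "block [Cond (less Mass Total) Fail Skip, Cond (less Total Mass) Fail Skip, ?E]"
  let ?Loop = "Loop (less Zero Count) (block [count_next_level,
          Cond (less Zero Count) (block [plus_to Mass Count, incr Level]) Skip])"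
  let ?G = "Star (Cond (Sweep (Incr Total)) Skip Fail)"
  let ?C = "block [clear Level, clear Mass, clear Count, incr Count, ?Loop, Cond (less Mass Total) Fail Skip, Cond (less Total Mass) Fail Skip, ?E]"
  have b0: "binary 0 = [False]" by (simp add: binary.simps)
  have L0: "0 < L" using width by (cases L) auto
  have "runs w L out (?C # []) (\<rho>'(Total := t'), h', []) (of_bool (t' = depth_sum n))"
    if \<rho>': "\<rho>' Zero = 0" "\<rho>' Size = n" "\<rho>' Base = base" for \<rho>' h' t'
  proof -
    \<comment> \<open>With 1 claimed for the right guess and 0 for any other, the condition
      \<open>t = depth_sum n \<or> m = 0\<close> holds for every guess.\<close>
    have "runs w L out (?Loop # ?T # []) (\<rho>'(Total := t', Level := 0, Mass := 0, Count := 1), h', [])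
      (of_bool (t' = depth_sum n))"
    proof (rule runs_level_loop[where t = t' and k = 0])
      fix \<rho>1 h1 k'
      assume *: "\<rho>1 Total = t'" "\<rho>1 Level = k'" "\<rho>1 Mass = depth_sum n"
        "\<exists>x<n. k' \<le> depth x" "\<forall>x<n. depth x \<le> k'"
      have "k' = k" using * K by (metis le_antisym le_trans)
      then show "runs w L out (?T # []) (\<rho>1, h1, []) (of_bool (t' = depth_sum n))"
        using * out b0 by (auto simp: runs_simps)
    qed (use \<rho>' n_pos in \<open>auto simp: capped_sum_def\<close>)
    then show ?thesis using L0 by (simp add: runs_simps)
  qed
  note tail = this
  have "runs w L out (?G # ?C # []) (\<rho>'(Total := 0), h', [])
      (\<Sum>t'=0..<2 ^ L. of_bool (t' = depth_sum n))"
    if \<rho>': "\<rho>' Zero = 0" "\<rho>' Size = n" "\<rho>' Base = base" for \<rho>' h'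
    using tail[OF \<rho>'] by (intro runs_guess_total) auto
  \<comment> \<open>The right total lies in the range of the guess, because sums of depths are below
    \<open>2 ^ L\<close>.\<close>
  moreover have "(\<Sum>t'=0..<2 ^ L. of_bool (t' = depth_sum n) :: nat) = 1"
    using sums_less_power(2)[of n] by (simp add: of_bool_def)
  ultimately have "runs w L out (?G # ?C # []) (\<rho>'(Total := 0), h', []) 1"
    if \<rho>': "\<rho>' Zero = 0" "\<rho>' Size = n" "\<rho>' Base = base" for \<rho>' h'
    using \<rho>' by metis
  then have "runs w L out (parse # block [clear Total, ?G, clear Level, clear Mass, clear Count, incr Count,
      ?Loop, Cond (less Mass Total) Fail Skip, Cond (less Total Mass) Fail Skip, ?E] # []) (\<rho>, h, []) 1"
    using assms(2) width by (intro runs_parse[OF assms(1)]) (simp_all add: runs_simps)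
  then show ?thesis
    unfolding longest_path_program_def by (simp add: runs_simps)
qed

end

section \<open>Instances\<close>

lemma length_rows: "length (concat (map (\<lambda>u. map (f u) [0..<n]) [0..<m])) = m * n"
  by (induction m) auto

lemma nth_rows:
  "u < m \<Longrightarrow> v < n \<Longrightarrow> concat (map (\<lambda>u. map (f u) [0..<n]) [0..<m]) ! (v + u * n) = f u v"
proof (induction m)
  case (Suc m)
  show ?case
  proof (cases "u < m")
    case True
    then have "Suc u * n \<le> m * n" by (intro mult_le_mono1) simp
    then have "v + u * n < m * n" using Suc.prems by simp
    then show ?thesis using Suc True by (simp add: nth_append length_rows)
  next
    case False
    then have "u = m" using Suc.prems by simp
    then show ?thesis using Suc.prems by (simp add: nth_append length_rows)
  qed
qed simp

lemma adjacency_matrix_rows: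
  "adjacency_matrix n E = concat (map (\<lambda>u. map (\<lambda>v. (u, v) \<in> E) [0..<n]) [0..<n])"
  by (simp add: adjacency_matrix_def)

section \<open>Backward walks and the paths of the graph library\<close>

lemma pcas_append: "pcas a (p @ q) b \<longleftrightarrow> (\<exists>c. pcas a p c \<and> pcas c q b)"
  by (induction p arbitrary: a) auto

lemma pawalk_verts_snoc: "pcas a p (fst e) \<Longrightarrow> pawalk_verts a (p @ [e]) = pawalk_verts a p @ [snd e]"
  by (induction p arbitrary: a) auto

text \<open>The library represents a path by its arcs in forward order, so the arc of each further
  predecessor goes in front.\<close>

fun walk_arcs :: "'a \<Rightarrow> 'a list \<Rightarrow> ('a \<times> 'a) list" where
  "walk_arcs u [] = []"
| "walk_arcs u (v # vs) = walk_arcs v vs @ [(v, u)]"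

lemma length_walk_arcs: "length (walk_arcs u vs) = length vs"
  by (induction vs arbitrary: u) auto

lemma walk_arcs_inverse: "rev (map fst (walk_arcs u vs)) = vs"
  by (induction vs arbitrary: u) auto

lemma pcas_walk_arcs: "pcas (last (u # vs)) (walk_arcs u vs) u"
  by (induction vs arbitrary: u) (auto simp: pcas_append)

lemma pawalk_verts_walk_arcs: "pawalk_verts (last (u # vs)) (walk_arcs u vs) = rev (u # vs)"
proof (induction vs arbitrary: u)
  case (Cons v vs)
  then show ?case
    using pcas_walk_arcs[of v vs] pawalk_verts_snoc[of "last (v # vs)" "walk_arcs v vs" "(v, u)"]
    by simp
qed simp

lemma back_walk_iff: "back_walk E u vs \<longleftrightarrow> set (walk_arcs u vs) \<subseteq> E"
  by (induction vs arbitrary: u) auto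

lemma walk_arcs_surj:
  "pcas a p u \<Longrightarrow> walk_arcs u (rev (map fst p)) = p \<and> last (u # rev (map fst p)) = a"
proof (induction p arbitrary: u rule: rev_induct)
  case (snoc e p)
  then have "pcas a p (fst e)" "snd e = u" by (auto simp: pcas_append)
  with snoc.IH[of "fst e"] show ?case by (auto simp: prod_eq_iff)
qed simp

lemma back_walk_append:
  "back_walk E u (vs @ [z]) \<longleftrightarrow> back_walk E u vs \<and> (z, last (u # vs)) \<in> E"
  by (induction vs arbitrary: u) auto

section \<open>Unique longest walks in a max-unique acyclic graph\<close>

locale max_unique_dag =
  fixes G :: "nat pair_pre_digraph" and s t n :: nat
  assumes verts: "pverts G = {..<n}" and dag: "dag (with_proj G)"
    and source: "unique_source (with_proj G) s" and sink: "unique_sink (with_proj G) t"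
    and max_unique: "max_unique (with_proj G)"
begin

sublocale fin_digraph "with_proj G"
  using dag by (simp add: dag_def)

lemma arcs_verts: "parcs G \<subseteq> {..<n} \<times> {..<n}"
  using tail_in_verts head_in_verts verts by fastforce

lemma wf_arcs: "wf (parcs G)"
proof (rule finite_acyclic_wf)
  show "finite (parcs G)" using finite_arcs by simp
  have "(a, a) \<notin> (parcs G)\<^sup>+" for a
  proof
    assume "(a, a) \<in> (parcs G)\<^sup>+"
    then have "\<exists>p. awalk a p a \<and> p \<noteq> []" using reachable1_awalk[of a a] by simp
    then have "\<exists>c. cycle c" using closed_w_imp_cycle by (auto simp: closed_w_def)
    then show False using dag by (simp add: dag_def)
  qed
  then show "acyclic (parcs G)" by (simp add: acyclic_def)
qed

lemma source_less: "s < n" and sink_less: "t < n"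
  using source sink verts by (auto simp: unique_source_def unique_sink_def)

lemma source_eq:
  assumes "a < n" "\<And>z. (z, a) \<notin> parcs G"
  shows "a = s"
proof -
  have "in_arcs (with_proj G) a = {}" using assms by (auto simp: in_arcs_def)
  then have "a \<in> {v \<in> verts (with_proj G). in_degree (with_proj G) v = 0}"
    using assms verts by (simp add: in_degree_def)
  then show ?thesis using source unfolding unique_source_def by blast
qed

lemma sink_eq:
  assumes "a < n" "\<And>z. (a, z) \<notin> parcs G"
  shows "a = t"
proof -
  have "out_arcs (with_proj G) a = {}" using assms by (auto simp: out_arcs_def)
  then have "a \<in> {v \<in> verts (with_proj G). out_degree (with_proj G) v = 0}"
    using assms verts by (simp add: out_degree_def)
  then show ?thesis using sink unfolding unique_sink_def by blast
qed

lemma apath_walk_arcs: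
  assumes "u < n" "back_walk (parcs G) u vs"
  shows "apath (last (u # vs)) (walk_arcs u vs) u"
proof -
  have "distinct (u # vs)" using back_walk_distinct[OF wf_acyclic[OF wf_arcs] assms(2)] .
  moreover have "set (u # vs) \<subseteq> {..<n}" using assms back_walk_subset[OF arcs_verts assms(2)] by auto
  then have "last (u # vs) < n" using last_in_set[of "u # vs"] by blast
  ultimately show ?thesis
    using assms(2) pawalk_verts_walk_arcs[of u vs] verts pcas_walk_arcs[of u vs]
    by (simp add: apath_def awalk_def cas_with_proj_eq awalk_verts_with_proj_eq back_walk_iff)
qed

lemma apath_back_walk:
  assumes "apath a p u"
  shows "back_walk (parcs G) u (rev (map fst p))" "walk_arcs u (rev (map fst p)) = p"
    "last (u # rev (map fst p)) = a"
  using assms walk_arcs_surj[of a p u]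
  by (auto simp: apath_def awalk_def cas_with_proj_eq back_walk_iff)

definition longest_back_walk :: "nat \<Rightarrow> nat list \<Rightarrow> bool" where
  "longest_back_walk u vs \<longleftrightarrow> back_walk (parcs G) u vs \<and>
     (\<forall>ws. back_walk (parcs G) u ws \<longrightarrow> length ws \<le> length vs)"

text \<open>A predecessor of the first vertex would lengthen the walk, so that vertex has in-degree
  0 and must be the unique source.\<close>

lemma longest_back_walk_source:
  assumes "u < n" "longest_back_walk u vs"
  shows "last (u # vs) = s"
proof (rule source_eq)
  show "last (u # vs) < n"
    using apath_walk_arcs[OF assms(1)] assms(2) verts
    by (auto simp: longest_back_walk_def apath_def awalk_def)
  fix z show "(z, last (u # vs)) \<notin> parcs G"
    using assms(2) back_walk_append[of "parcs G" u vs z] by (fastforce simp: longest_back_walk_def)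
qed

lemma longest_path_walk_arcs:
  assumes "u < n" "longest_back_walk u vs"
  shows "longest_path (with_proj G) s (walk_arcs u vs) u"
  unfolding longest_path_def
proof (intro conjI allI impI)
  show "apath s (walk_arcs u vs) u"
    using apath_walk_arcs[OF assms(1)] longest_back_walk_source[OF assms] assms(2)
    by (auto simp: longest_back_walk_def)
  fix q assume "apath s q u"
  then show "length q \<le> length (walk_arcs u vs)"
    using apath_back_walk(1)[of s q u] assms(2) by (auto simp: longest_back_walk_def length_walk_arcs)
qed

text \<open>Existence follows from the bound \<open>n\<close> on lengths. Two longest walks ending
  at \<open>u\<close> both begin at \<open>s\<close>, so they are longest paths between the same two
  vertices and max-uniqueness applies.\<close>

lemma ex1_longest_back_walk:
  assumes "u < n"
  shows "\<exists>!vs. longest_back_walk u vs"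
proof (rule ex_ex1I)
  have "length vs < n" if "back_walk (parcs G) u vs" for vs
    using back_walk_length[OF wf_acyclic[OF wf_arcs] arcs_verts _ _ that] assms by simp
  then show "\<exists>vs. longest_back_walk u vs"
    using ex_has_greatest_nat[of "back_walk (parcs G) u" "[]" length n]
    unfolding longest_back_walk_def by auto
next
  fix vs ws assume *: "longest_back_walk u vs" "longest_back_walk u ws"
  have lp: "longest_path (with_proj G) s (walk_arcs u vs) u"
    "longest_path (with_proj G) s (walk_arcs u ws) u"
    using longest_path_walk_arcs[OF assms] * by blast+
  have "s \<in> verts (with_proj G)" "u \<in> verts (with_proj G)"
    by (simp_all add: verts assms source_less)
  moreover have "\<exists>p. apath s p u" using lp(1) unfolding longest_path_def by blast
  ultimately have "\<exists>!p. longest_path (with_proj G) s p u"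
    using max_unique unfolding max_unique_def by blast
  with lp have "walk_arcs u vs = walk_arcs u ws" by blast
  then show "vs = ws" by (metis walk_arcs_inverse)
qed

sublocale max_unique_walks "parcs G" n
  using arcs_verts wf_arcs source_less ex1_longest_back_walk
  by unfold_locales (auto simp: longest_back_walk_def)

text \<open>A vertex of maximal depth has no outgoing arc, since the head of such an arc would be
  deeper; hence it is the unique sink.\<close>

lemma depth_le_sink: "x < n \<Longrightarrow> depth x \<le> depth t"
proof -
  obtain x0 where x0: "x0 < n" "\<And>x. x < n \<Longrightarrow> depth x \<le> depth x0"
    using Max_in[of "depth ` {..<n}"] Max_ge[of "depth ` {..<n}"] n_pos by fastforce
  have "x0 = t"
  proof (rule sink_eq[OF x0(1)])
    fix z show "(x0, z) \<notin> parcs G"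
    proof
      assume e: "(x0, z) \<in> parcs G"
      then have "z < n" using E_less by blast
      then show False using Suc_le_depth[of z "depth x0"] x0 e by fastforce
    qed
  qed
  then show "x < n \<Longrightarrow> depth x \<le> depth t" using x0 by blast
qed

text \<open>The depth maximises over all first vertices; prescribing \<open>s\<close> does not lower
  the maximum, as a longest walk ending at \<open>t\<close> begins there anyway.\<close>

lemma longest_path_length_eq: "longest_path_length (with_proj G) s t = depth t"
  unfolding longest_path_length_def
proof (rule Max_eqI)
  have le: "length p \<le> depth t" if "apath s p t" for p
    using apath_back_walk(1)[OF that] length_le_depth[OF sink_less, of "rev (map fst p)"]
    by (simp add: walks_def)
  have "length ` {p. apath s p t} \<subseteq> {..depth t}" using le by auto
  then show "finite (length ` {p. apath s p t})" by (rule finite_subset) simp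
  show "y \<le> depth t" if "y \<in> length ` {p. apath s p t}" for y using that le by auto
  obtain vs where vs: "vs \<in> walks t" "length vs = depth t" using depth_walk[OF sink_less] .
  then have "longest_back_walk t vs"
    using length_le_depth[OF sink_less] by (auto simp: longest_back_walk_def walks_def)
  from longest_path_walk_arcs[OF sink_less this]
  show "depth t \<in> length ` {p. apath s p t}"
    using vs by (auto simp: longest_path_def length_walk_arcs intro!: image_eqI)
qed

lemma runs_encode:
  assumes "w = unary n @ unary s @ unary t @ adjacency_matrix n (parcs G)"
  shows "runs w (width (length w)) (binary (longest_path_length (with_proj G) s t))
    [longest_path_program] (\<rho>, h, []) 1"
proof -
  have len: "length w = n + s + t + 3 + n * n"
    by (simp add: assms unary_def adjacency_matrix_rows length_rows)
  interpret max_unique_input "parcs G" n w "width (length w)" "n + s + t + 4"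
    "binary (longest_path_length (with_proj G) s t)"
  proof unfold_locales
    fix v u assume vu: "v < n" "u < n"
    have "u + v * n < n * n"
    proof -
      have "u + v * n < Suc v * n" "Suc v * n \<le> n * n"
        using vu by (simp, intro mult_le_mono1) simp
      then show ?thesis by simp
    qed
    \<comment> \<open>Cell 0 holds the left end marker, so letter \<open>j\<close> of the word is
      read in cell \<open>Suc j\<close>.\<close>
    then have "input_cell w (Suc (n + s + t + 3 + (u + v * n))) = Bit (w ! (n + s + t + 3 + (u + v * n)))"
      using len by (intro input_cell_Suc) simp
    also have "w ! (n + s + t + 3 + (u + v * n)) = adjacency_matrix n (parcs G) ! (u + v * n)"
      unfolding assms by (simp add: nth_append unary_def)
    also have "\<dots> = ((v, u) \<in> parcs G)"
      unfolding adjacency_matrix_rows using vu by (rule nth_rows)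
    finally show "input_cell w (n + s + t + 4 + u + v * n) = Bit ((v, u) \<in> parcs G)"
      by (simp add: eval_nat_numeral add.assoc)
  next
    show "n + s + t + 4 + n * n \<le> Suc (length w)" using len by simp
    show "Suc (length w) < 2 ^ width (length w)" by (rule less_two_power_width)
  qed
  show ?thesis
    using depth_le_sink sink_less
    by (intro runs_longest_path_program[OF assms refl, where k = "depth t"])
      (auto simp: longest_path_length_eq)
qed

end

theorem theorem10:
  shows "computable_in_UL_coUL max_unique_instances encode
           (\<lambda>(G, s, t). longest_path_length (with_proj G) s t)"
proof (rule computable_by_program)
  fix x assume "x \<in> max_unique_instances"
  then obtain G s t where x: "x = (G, s, t)" and "max_unique_dag G s t (card (pverts G))"
    by (auto simp: max_unique_instances_def max_unique_dag_def)
  from this(2) have "runs (encode x) (width (length (encode x)))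
      (binary (longest_path_length (with_proj G) s t)) [longest_path_program]
      (\<lambda>_. Suc (length (encode x)), Suc (length (encode x)), []) 1"
    by (rule max_unique_dag.runs_encode) (simp add: x Let_def)
  then show "runs (encode x) (width (length (encode x)))
      (binary (case x of (G, s, t) \<Rightarrow> longest_path_length (with_proj G) s t)) [longest_path_program]
      (\<lambda>_. Suc (length (encode x)), Suc (length (encode x)), []) 1"
    by (simp only: x prod.case)
qed

end
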